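(* Fix $2 \leq p \leq 4$ and let $\min(2/\pi, 2/p) \leq \delta_1 \leq 1$ and $2/3 \leq \delta_2 \leq 1$. Then $$\mathscr{E}_p(\delta_1, \delta_2)=\sum_{n=0}^{\infty} \int_{n}^{n+2/p} \frac{\sin^2\left(\frac{p}{2}\pi(x-n)\right)}{\pi^2 x^2} \, dx.$$ For $2 \leq p <4$ the supremum defining $\mathscr{E}_p(\delta_1,\delta_2)$ is attained at $\tau \in T(\delta_1,\delta_2)$ if and only if $\tau_n$ is in the interval $[n-1+2/p,\,n]$ for all $n \geq 1$. If $p=4$, then the supremum is attained for all sequences $\tau$ in $T(\delta_1, \delta_2)$.
   Context: For $\delta_1,\delta_2>0$ let $T(\delta_1,\delta_2)$ be the set of strictly increasing real sequences $\tau=(\tau_n)_{n\ge 0}$ with $\tau_0=0$, $\tau_1\ge\delta_1$ and $\tau_{n+1}-\tau_n\ge\delta_2$ for all $n\ge1$. For $0<p<\infty$ and such a sequence $\tau$ define $$K_p(\tau;x)=\sum_{n=0}^\infty \chi_{(\tau_n,\tau_{n+1})}(x)\,\frac{\sin\left(\frac p2\pi(x-n)\right)}{\pi x},\qquad E_p(\tau)=\int_0^\infty\left(\max\left(0,K_p(\tau;x)\right)\right)^2dx,$$ where $\chi_{(a,b)}$ is the characteristic function of $(a,b)$, and $$\mathscr{E}_p(\delta_1,\delta_2)=\sup_{\tau\in T(\delta_1,\delta_2)}E_p(\tau).$$ *)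

theory Defs
  imports "HOL-Analysis.Analysis"
begin

definition Tseq :: "real \<Rightarrow> real \<Rightarrow> (nat \<Rightarrow> real) set" where
  "Tseq \<delta>1 \<delta>2 =
     {\<tau>. strict_mono \<tau> \<and> \<tau> 0 = 0 \<and> \<tau> 1 \<ge> \<delta>1 \<and> (\<forall>n\<ge>1. \<tau> (Suc n) - \<tau> n \<ge> \<delta>2)}"

definition Kp :: "real \<Rightarrow> (nat \<Rightarrow> real) \<Rightarrow> real \<Rightarrow> real" where
  "Kp p \<tau> x =
     (\<Sum>n. indicator {\<tau> n<..<\<tau> (Suc n)} x * (sin (p / 2 * pi * (x - real n)) / (pi * x)))"

text \<open>The integrand is nonnegative, so the integral and the supremum are taken in the extended
  nonnegative reals, where both exist without any integrability or boundedness hypothesis.\<close>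

definition Ep :: "real \<Rightarrow> (nat \<Rightarrow> real) \<Rightarrow> ennreal" where
  "Ep p \<tau> = (\<integral>\<^sup>+x\<in>{0<..}. ennreal ((max 0 (Kp p \<tau> x))\<^sup>2) \<partial>lborel)"

definition Esup :: "real \<Rightarrow> real \<Rightarrow> real \<Rightarrow> ennreal" where
  "Esup p \<delta>1 \<delta>2 = (SUP \<tau>\<in>Tseq \<delta>1 \<delta>2. Ep p \<tau>)"

end

theory Submission
  imports Defs
begin

text \<open>
  Put \<open>L = 2 / p\<close>, which lies between \<open>1/2\<close> and \<open>1\<close>.  On \<open>(\<tau>\<^sub>n, \<tau>\<^sub>n\<^sub>+\<^sub>1)\<close> the integrand of \<open>E\<^sub>p\<close> is a wave train
  of squared positive half-waves, of length \<open>L\<close> and period \<open>2 L\<close>, times the weight \<open>1 / (pi x)\<^sup>2\<close>.  Passing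
  from \<open>n\<close> to \<open>n + 1\<close> at \<open>\<tau>\<^sub>n\<^sub>+\<^sub>1\<close> switches to the same train shifted to the left by \<open>2 L - 1\<close>, modulo the period.

  Abel summation (\<open>part_difference\<close>) writes the difference between the value of \<open>E\<^sub>p\<close> for the
  sequence \<open>n\<close> and \<open>E\<^sub>p (\<tau>)\<close> as a sum of deficits, one for each switch,
  where the deficit of a switch depends only on its place.  It vanishes if the switch to index \<open>m + 1\<close>
  takes place in \<open>[m + L, m + 1]\<close>, where both trains are zero, and it is positive for later switches, which
  delay half-waves to places of smaller weight (\<open>deficit_pos\<close>).  For \<open>p = 4\<close> the shift is zero and there
  are no deficits at all.

  An early switch is more delicate.  It loses a stretch of length \<open>2 L - 1\<close> of a half-wave, but the
  half-waves after it come earlier, at places of larger weight.  If the switch takes place before the whole half-wave,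
  only this gain is left, and the deficit of that single switch is negative.  Here the spacing comes in:
  the phase \<open>\<tau>\<^sub>m\<^sub>+\<^sub>1 - m\<close> is at least \<open>1/2\<close> for \<open>m = 0\<close> and falls by at most \<open>1/3\<close> from each \<open>m\<close> to the next.  It
  therefore cannot jump over a half-wave, and on the way to the region of gains it has to stop at lossy
  places.

  To make this quantitative, the deficit is cut into one piece for each period passed by the phase
  (\<open>integral_gap_eq_sum_levels\<close>).  By periodicity all periods look alike, except for an offset in the
  weight, and within one period it suffices to compare the first phase below \<open>(1 - L) / 2\<close> and its
  predecessor with all gains of later switches.  These gains telescope (\<open>sum_gain_le\<close>), and in \<open>pair_pays\<close>
  and \<open>first_step_pays\<close> the losses of those two switches are shown to exceed the sum of the gains by a fixed
  margin.  After lower bounds for a few integrals of the squared sine, this comes down to inequalities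
  between polynomials.  Summing over the periods and over the switches gives the inequality
  (\<open>total_le\<close>), and the margins give the characterization of equality (\<open>total_eq_iff\<close>).
\<close>

section \<open>Half-waves\<close>

text \<open>
  With \<open>L = 2 / p\<close> the square of the positive part of \<open>K\<^sub>p\<close> on \<open>(\<tau>\<^sub>n, \<tau>\<^sub>n\<^sub>+\<^sub>1)\<close> is
  \<open>bump L (x - n) / (pi x)\<^sup>2\<close>: one positive half-wave of length \<open>L\<close> in each period \<open>2 L\<close>.
\<close>
definition bump :: "real \<Rightarrow> real \<Rightarrow> real" where
  "bump L z = (max 0 (sin (pi * z / L)))\<^sup>2"

lemma bump_nonneg: "0 \<le> bump L z"
  by (simp add: bump_def)

lemma bump_le_1: "bump L z \<le> 1"
  unfolding bump_def by (rule power_le_one) (auto simp: max_def)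

lemma continuous_on_bump [continuous_intros]:
  fixes f :: "real \<Rightarrow> real"
  shows "continuous_on S f \<Longrightarrow> continuous_on S (\<lambda>x. bump L (f x))"
  unfolding bump_def times_divide_eq_left[symmetric] by (intro continuous_intros)

lemma bump_periodic:
  assumes "L > 0" shows "bump L (z + 2 * L * of_int k) = bump L z"
proof -
  have "pi * (z + 2 * L * of_int k) / L = pi * z / L + of_int k * (2 * pi)"
    using assms by (simp add: field_simps)
  moreover have "sin (of_int k * (2 * pi)) = 0" "cos (of_int k * (2 * pi)) = 1"
    using sin_int_2pin[of k] cos_int_2pin[of k] by (simp_all add: ac_simps)
  ultimately have "sin (pi * (z + 2 * L * of_int k) / L) = sin (pi * z / L)"
    by (simp add: sin_add)
  then show ?thesis by (simp add: bump_def)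
qed

lemma bump_eq_sin:
  assumes "0 \<le> z" "z \<le> L" "0 < L" shows "bump L z = (sin (pi * z / L))\<^sup>2"
proof -
  have "0 \<le> sin (pi * z / L)"
    using assms by (intro sin_ge_zero) (auto simp: field_simps)
  then show ?thesis by (simp add: bump_def)
qed

lemma bump_pos:
  assumes "0 < z" "z < L" shows "0 < bump L z"
proof -
  have "0 < sin (pi * z / L)"
    using assms by (intro sin_gt_zero) (auto simp: field_simps)
  then show ?thesis by (simp add: bump_def)
qed

lemma bump_left_zero:
  assumes "-L \<le> z" "z \<le> 0" "0 < L" shows "bump L z = 0"
proof -
  have "pi * (- z) \<le> pi * L" "0 \<le> pi * (- z)"
    using assms by (intro mult_left_mono mult_nonneg_nonneg; simp)+
  then have "0 \<le> sin (- (pi * z / L))"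
    using assms by (intro sin_ge_zero) (simp_all add: field_simps)
  then show ?thesis by (simp add: bump_def)
qed

lemma bump_right_zero:
  assumes "L \<le> z" "z \<le> 2 * L" "0 < L" shows "bump L z = 0"
  using bump_left_zero[of L "z - 2 * L"] bump_periodic[of L "z - 2*L" 1] assms by simp

text \<open>
  From \<open>sin\<^sup>2 a - sin\<^sup>2 b = - sin (a + b) sin (b - a)\<close>; the sign therefore depends only on which side of
  the crest the midpoint of the two points lies.
\<close>
lemma bump_diff_eq:
  assumes "0 \<le> z" "z \<le> L" "0 \<le> z + s" "z + s \<le> L" "0 < L"
  shows "bump L z - bump L (z + s) = - sin (pi * (2 * z + s) / L) * sin (pi * s / L)"
proof -
  have *: "(sin a)\<^sup>2 - (sin b)\<^sup>2 = - sin (a + b) * sin (b - a)" for a b :: real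
    unfolding sin_add sin_diff using sin_cos_squared_add[of a] sin_cos_squared_add[of b] by algebra
  have "pi * z / L + pi * (z + s) / L = pi * (2 * z + s) / L" "pi * (z + s) / L - pi * z / L = pi * s / L"
    by (simp_all add: add_divide_distrib diff_divide_distrib algebra_simps)
  then show ?thesis
    using *[of "pi * z / L" "pi * (z + s) / L"] assms by (simp add: bump_eq_sin)
qed

text \<open>
  The next wave is the old one shifted to the left by \<open>2 L - 1\<close>.  On the period \<open>[-L, L]\<close> their order
  changes at \<open>(1 - L) / 2\<close>, the crossing point, since there the points \<open>z\<close> and \<open>z + (2 L - 1)\<close> lie
  symmetrically about the crest \<open>L / 2\<close>.
\<close>
lemma bump_ge_shifted:
  assumes "0 < L" "L \<le> 1" "1/2 \<le> L" "1 - L \<le> 2 * z" "z \<le> L"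
  shows "bump L (z + (2 * L - 1)) \<le> bump L z"
proof (cases "z + (2 * L - 1) \<le> L")
  case True
  let ?A = "pi * (2 * z + (2 * L - 1)) / L"
  have z: "0 \<le> z" using assms by linarith
  have "pi * L \<le> pi * (2 * z + (2 * L - 1))" "pi * (2 * z + (2 * L - 1)) \<le> pi * (2 * L)"
    using assms True by (intro mult_left_mono; simp)+
  then have "pi \<le> ?A" "?A \<le> 2 * pi" using assms(1) by (simp_all add: field_simps)
  then have "sin ?A \<le> 0" using sin_le_zero[of ?A] by (cases "?A = 2 * pi") auto
  moreover have "0 \<le> sin (pi * (2 * L - 1) / L)"
    using assms by (intro sin_ge_zero) (auto simp: field_simps)
  ultimately have "0 \<le> - sin ?A * sin (pi * (2 * L - 1) / L)" by (simp add: mult_nonpos_nonneg)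
  then show ?thesis using bump_diff_eq[of z L "2 * L - 1"] assms True z by simp
next
  case False
  then have "bump L (z + (2 * L - 1)) = 0" using assms by (intro bump_right_zero) auto
  then show ?thesis by (simp add: bump_nonneg)
qed

lemma bump_le_shifted:
  assumes "0 < L" "L \<le> 1" "1/2 \<le> L" "2 * z \<le> 1 - L" "-L \<le> z"
  shows "bump L z \<le> bump L (z + (2 * L - 1))"
proof (cases "0 \<le> z")
  case True
  let ?A = "pi * (2 * z + (2 * L - 1)) / L"
  have z: "0 \<le> z" "z \<le> L" using assms True by linarith+
  have "pi * (2 * z + (2 * L - 1)) \<le> pi * L" "0 \<le> pi * (2 * z + (2 * L - 1))"
    using assms True by (intro mult_left_mono mult_nonneg_nonneg; simp)+
  then have "?A \<le> pi" "0 \<le> ?A" using assms(1) by (simp_all add: field_simps)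
  then have "0 \<le> sin ?A" by (simp add: sin_ge_zero)
  moreover have "0 \<le> sin (pi * (2 * L - 1) / L)"
    using assms by (intro sin_ge_zero) (auto simp: field_simps)
  ultimately have "0 \<le> sin ?A * sin (pi * (2 * L - 1) / L)" by simp
  then show ?thesis using bump_diff_eq[of z L "2 * L - 1"] assms True z by simp
next
  case False
  then have "bump L z = 0" using assms by (intro bump_left_zero) auto
  then show ?thesis by (simp add: bump_nonneg)
qed

section \<open>Mass of a half-wave beyond a point\<close>

definition tail_mass :: "real \<Rightarrow> real \<Rightarrow> real" where
  "tail_mass L t = integral {t..L} (bump L)"

lemma bump_integrable: "bump L integrable_on {a..b}"
  by (intro integrable_continuous_real continuous_on_bump[of _ "\<lambda>x. x", simplified])

lemma tail_mass_eq:
  assumes "0 < L" "0 \<le> t" "t \<le> L"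
  shows "tail_mass L t = (L - t) / 2 + L / (4 * pi) * sin (2 * pi * t / L)"
proof -
  define F where "F z = z / 2 - L / (4 * pi) * sin (2 * pi * z / L)" for z
  have "(bump L has_integral (F L - F t)) {t..L}"
  proof (rule fundamental_theorem_of_calculus[OF assms(3)])
    fix z assume z: "z \<in> {t..L}"
    have "(F has_real_derivative 1 / 2 - cos (2 * pi * z / L) / 2) (at z)"
      unfolding F_def using assms(1) by (auto intro!: derivative_eq_intros simp: field_simps)
    moreover have "bump L z = 1 / 2 - cos (2 * pi * z / L) / 2"
      using bump_eq_sin[of z L] z assms cos_double_sin[of "pi * z / L"] by (simp add: mult.assoc field_simps)
    ultimately show "(F has_vector_derivative bump L z) (at z within {t..L})"
      by (simp add: has_real_derivative_iff_has_vector_derivative has_vector_derivative_at_within)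
  qed
  moreover have "F L - F t = (L - t) / 2 + L / (4 * pi) * sin (2 * pi * t / L)"
    using assms(1) by (simp add: F_def diff_divide_distrib)
  ultimately show ?thesis
    unfolding tail_mass_def by (simp add: integral_unique)
qed

lemma tail_mass_beyond: "L \<le> t \<Longrightarrow> tail_mass L t = 0"
  by (cases "t = L") (simp_all add: tail_mass_def)

lemma tail_mass_before:
  assumes "0 < L" "-L \<le> t" "t \<le> 0" shows "tail_mass L t = L / 2"
proof -
  have "integral {t..0} (bump L) = integral {t..0} (\<lambda>_. 0)"
    using assms by (intro integral_cong) (auto intro: bump_left_zero)
  moreover have "integral {t..0} (bump L) + integral {0..L} (bump L) = integral {t..L} (bump L)"
    using assms by (intro Henstock_Kurzweil_Integration.integral_combine bump_integrable) auto
  ultimately show ?thesis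
    using tail_mass_eq[of L 0] assms by (simp add: tail_mass_def)
qed

lemma tail_mass_antimono:
  assumes "t \<le> t'" shows "tail_mass L t' \<le> tail_mass L t"
  unfolding tail_mass_def using assms
  by (intro integral_subset_le) (auto simp: bump_nonneg bump_integrable)

lemma tail_mass_le:
  assumes "0 < L" "-L \<le> t" shows "tail_mass L t \<le> L / 2"
  using tail_mass_before[of L "-L"] tail_mass_antimono[of "-L" t L] assms by simp

lemma tail_mass_reflect:
  assumes "0 < L" "0 \<le> t" "t \<le> L"
  shows "tail_mass L (L - t) = L / 2 - tail_mass L t"
proof -
  have "2 * pi * (L - t) / L = 2 * pi - 2 * pi * t / L"
    using assms(1) by (simp add: field_simps)
  then have "sin (2 * pi * (L - t) / L) = - sin (2 * pi * t / L)"
    by (simp add: sin_diff)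
  then show ?thesis using assms by (simp add: tail_mass_eq field_simps)
qed

lemma tail_mass_ge_half:
  assumes "0 < L" "0 \<le> t" "2 * t \<le> L" shows "(L - t) / 2 \<le> tail_mass L t"
proof -
  have "pi * (2 * t) \<le> pi * L" "0 \<le> pi * (2 * t)"
    using assms by (intro mult_left_mono mult_nonneg_nonneg; simp)+
  then have "0 \<le> sin (2 * pi * t / L)"
    using assms by (intro sin_ge_zero) (simp_all add: field_simps)
  then show ?thesis using assms by (simp add: tail_mass_eq)
qed

text \<open>
  Beyond the crest the tail mass is a convex function of \<open>t\<close>, and the bound is its tangent at
  \<open>t = L / 2\<close>, where the wave has height \<open>1\<close> and half of the mass \<open>L / 2\<close> is left.
\<close>
lemma tail_mass_ge_tangent:
  assumes "0 < L" "L \<le> 2 * t" "t \<le> L" shows "(L - t) - L / 4 \<le> tail_mass L t"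
proof -
  define y where "y = 2 * pi * t / L - pi"
  have "pi * L \<le> pi * (2 * t)" using assms by (intro mult_left_mono) simp_all
  then have "0 \<le> y" using assms by (simp add: y_def field_simps)
  then have "sin y \<le> y" by (rule sin_x_le_x)
  moreover have "sin (2 * pi * t / L) = - sin y" unfolding y_def by (simp add: sin_diff)
  ultimately have "L / (4 * pi) * (- y) \<le> L / (4 * pi) * sin (2 * pi * t / L)"
    using assms(1) by (intro mult_left_mono) simp_all
  moreover have "L / (4 * pi) * (- y) = L / 4 - t / 2"
    using assms(1) by (simp add: y_def field_simps)
  ultimately show ?thesis using assms by (simp add: tail_mass_eq field_simps)
qed

text \<open>
  Switching to the next wave at phase \<open>t\<close> amounts to leaving out the stretch from \<open>t\<close> to
  \<open>t + (2 L - 1)\<close> of the old one; this is the unweighted mass of that stretch.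
\<close>
definition loss :: "real \<Rightarrow> real \<Rightarrow> real" where
  "loss L t = tail_mass L t - tail_mass L (t + (2 * L - 1))"

text \<open>
  The half-wave is symmetric, so the loss depends only on the distance of \<open>t\<close> from \<open>(1 - L) / 2\<close>, the
  phase at which the omitted stretch is centred at the crest.
\<close>
lemma loss_reflect:
  assumes "1/2 \<le> L" "L \<le> 1" "2 * t \<le> 1 - L" "1 - 2 * L \<le> t"
  shows "loss L (1 - L - t) = loss L t"
proof -
  have *: "L / 2 - tail_mass L y = tail_mass L (L - y)" if "-L \<le> y" "y \<le> 2 * L" for y
    using tail_mass_reflect[of L y] tail_mass_before[of L y] tail_mass_beyond[of L y]
      tail_mass_before[of L "L - y"] tail_mass_beyond[of L "L - y"] assms that
    by (cases "y < 0"; cases "L < y") simp_all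
  have "loss L (1 - L - t) = tail_mass L (L - (t + (2 * L - 1))) - tail_mass L (L - t)"
    by (simp add: loss_def algebra_simps)
  also have "\<dots> = loss L t"
    using *[of t] *[of "t + (2 * L - 1)"] assms by (simp add: loss_def)
  finally show ?thesis .
qed

lemma loss_eq:
  assumes "1/2 \<le> L" "0 \<le> t" "t + (2 * L - 1) \<le> L"
  shows "loss L t = (2 * L - 1) / 2 - L / (2 * pi) * cos (pi * (2 * t + (2 * L - 1)) / L) * sin (pi * (2 * L - 1) / L)"
proof -
  have "2 * pi * t / L = pi * (2 * t + (2 * L - 1)) / L - pi * (2 * L - 1) / L"
    "2 * pi * (t + (2 * L - 1)) / L = pi * (2 * t + (2 * L - 1)) / L + pi * (2 * L - 1) / L"
    by (simp_all add: add_divide_distrib diff_divide_distrib algebra_simps)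
  then have "sin (2 * pi * t / L) - sin (2 * pi * (t + (2 * L - 1)) / L)
      = - 2 * cos (pi * (2 * t + (2 * L - 1)) / L) * sin (pi * (2 * L - 1) / L)"
    by (simp add: sin_add sin_diff)
  then have "L / (4 * pi) * sin (2 * pi * t / L) - L / (4 * pi) * sin (2 * pi * (t + (2 * L - 1)) / L)
      = L / (4 * pi) * (- 2 * cos (pi * (2 * t + (2 * L - 1)) / L) * sin (pi * (2 * L - 1) / L))"
    unfolding right_diff_distrib[symmetric] by simp
  also have "\<dots> = - (L / (2 * pi) * cos (pi * (2 * t + (2 * L - 1)) / L) * sin (pi * (2 * L - 1) / L))"
    by simp
  finally show ?thesis
    using assms unfolding loss_def by (simp add: tail_mass_eq diff_divide_distrib add_divide_distrib)
qed

text \<open>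
  Concavity of the sine on \<open>[0, pi / 2]\<close>.
\<close>
lemma sin_ge_chord:
  fixes x :: real assumes "0 \<le> x" "x \<le> pi / 2" shows "2 / pi * x \<le> sin x"
proof -
  have "convex_on {0..pi / 2} (\<lambda>x. - sin x)"
    by (rule f''_ge0_imp_convex[where f' = "\<lambda>x. - cos x" and f'' = sin])
       (auto intro!: derivative_eq_intros sin_ge_zero)
  from convex_onD_Icc'[OF this, of x] show ?thesis
    using assms by (simp add: field_simps)
qed

text \<open>
  Machin's formula with \<open>arctan x \<le> x\<close>.
\<close>
lemma pi_le: "pi \<le> 16 / 5"
proof -
  have "arctan (1/5) \<le> 1/5"
  proof -
    have "\<exists>y. ((\<lambda>x. x - arctan x) has_real_derivative y) (at x) \<and> 0 \<le> y" for x :: real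
      by (rule exI[of _ "1 - inverse (1 + x\<^sup>2)"])
         (auto intro!: derivative_eq_intros simp: field_simps add_nonneg_eq_0_iff)
    then have "0 - arctan 0 \<le> 1/5 - arctan (1/5)"
      by (intro DERIV_nonneg_imp_nondecreasing[of 0 "1/5" "\<lambda>x. x - arctan x"]) auto
    then show ?thesis by simp
  qed
  moreover have "0 \<le> arctan (1/239)" by simp
  ultimately show ?thesis using machin by linarith
qed

text \<open>
  The omitted stretch is centred at distance \<open>1/8 \<le> L / 4\<close> from the crest, so that the wave is at least
  \<open>1/2\<close> at the centre and the cosine in \<open>loss_eq\<close> is nonpositive.
\<close>
lemma loss_ge_half:
  assumes "1/2 \<le> L" "L \<le> 2/3"
  shows "(2 * L - 1) / 2 \<le> loss L (3 / 8 - L / 2)"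
proof -
  have "pi * (2 * (3 / 8 - L / 2) + (2 * L - 1)) / L = pi - pi / (4 * L)"
    using assms by (simp add: field_simps)
  then have "cos (pi * (2 * (3 / 8 - L / 2) + (2 * L - 1)) / L) = - cos (pi / (4 * L))"
    by simp
  moreover have "0 \<le> pi / (4 * L)" "pi / (4 * L) \<le> pi / 2"
    using assms by (simp_all add: field_simps)
  then have "0 \<le> cos (pi / (4 * L))"
    using pi_ge_zero by (intro cos_ge_zero) linarith+
  moreover have "0 \<le> sin (pi * (2 * L - 1) / L)"
    using assms by (intro sin_ge_zero) (simp_all add: field_simps)
  ultimately show ?thesis
    using assms loss_eq[of L "3 / 8 - L / 2"] by simp
qed

text \<open>
  The same at distance \<open>1/12\<close>: the cosine is at least \<open>1/2\<close> in absolute value, and the chord bound for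
  the sine turns this into the mean \<open>1/2 + 1 / (2 pi)\<close>.
\<close>
lemma loss_ge_13_20:
  assumes "1/2 \<le> L" "L \<le> 5/9"
  shows "13 / 20 * (2 * L - 1) \<le> loss L (5 / 12 - L / 2)"
proof -
  have "pi * (2 * (5 / 12 - L / 2) + (2 * L - 1)) / L = pi - pi / (6 * L)"
    using assms by (simp add: field_simps)
  then have 1: "cos (pi * (2 * (5 / 12 - L / 2) + (2 * L - 1)) / L) = - cos (pi / (6 * L))"
    by simp
  have "cos (pi / 3) \<le> cos (pi / (6 * L))"
    using assms by (intro cos_monotone_0_pi_le) (simp_all add: field_simps)
  then have 2: "1 / 2 \<le> cos (pi / (6 * L))" by (simp add: cos_60)
  have "2 / pi * (pi * (2 * L - 1) / L) \<le> sin (pi * (2 * L - 1) / L)"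
    using assms by (intro sin_ge_chord) (simp_all add: field_simps)
  then have 3: "2 * (2 * L - 1) / L \<le> sin (pi * (2 * L - 1) / L)" by simp
  have "(2 * L - 1) / L = 1 / 2 * (2 * (2 * L - 1) / L)"
    using assms by (simp add: field_simps)
  also have "\<dots> \<le> cos (pi / (6 * L)) * sin (pi * (2 * L - 1) / L)"
    using 2 3 assms by (intro mult_mono) auto
  finally have "L / (2 * pi) * ((2 * L - 1) / L) \<le> L / (2 * pi) * (cos (pi / (6 * L)) * sin (pi * (2 * L - 1) / L))"
    using assms by (intro mult_left_mono) auto
  moreover have "L / (2 * pi) * ((2 * L - 1) / L) = (2 * L - 1) * (1 / (2 * pi))"
    using assms by (simp add: field_simps)
  moreover have "(2 * L - 1) * (3 / 20) \<le> (2 * L - 1) * (1 / (2 * pi))"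
    using assms pi_le by (intro mult_left_mono) (simp_all add: field_simps)
  moreover have "loss L (5 / 12 - L / 2) = (2 * L - 1) / 2 + L / (2 * pi) * (cos (pi / (6 * L)) * sin (pi * (2 * L - 1) / L))"
    using assms loss_eq[of L "5 / 12 - L / 2"] 1 by simp
  ultimately show ?thesis by linarith
qed

text \<open>
  When the cosine is unfavourable, the worst case is that of a very short stretch, whose mean is the
  value \<open>(1 + k) / 2\<close> of the wave at its centre; \<open>sin x \<le> x\<close> expresses this.
\<close>
lemma loss_ge_of_cos_ge:
  assumes "1/2 \<le> L" "L \<le> 2/3" "0 \<le> t" "t + (2 * L - 1) \<le> L"
    and "k \<le> - cos (pi * (2 * t + (2 * L - 1)) / L)" "k \<le> 0"
  shows "(2 * L - 1) * (1 + k) / 2 \<le> loss L t"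
proof -
  define S where "S = sin (pi * (2 * L - 1) / L)"
  have S: "0 \<le> S" unfolding S_def using assms by (intro sin_ge_zero) (simp_all add: field_simps)
  have "S \<le> pi * (2 * L - 1) / L" unfolding S_def using assms by (intro sin_x_le_x) simp
  then have "k * (pi * (2 * L - 1) / L) \<le> k * S" using assms by (intro mult_left_mono_neg) auto
  also have "\<dots> \<le> - cos (pi * (2 * t + (2 * L - 1)) / L) * S"
    using assms S by (intro mult_right_mono) auto
  finally have "L / (2 * pi) * (k * (pi * (2 * L - 1) / L)) \<le> L / (2 * pi) * (- cos (pi * (2 * t + (2 * L - 1)) / L) * S)"
    using assms by (intro mult_left_mono) auto
  moreover have "L / (2 * pi) * (k * (pi * (2 * L - 1) / L)) = k * (2 * L - 1) / 2"
    using assms by simp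
  moreover have "(2 * L - 1) * (1 + k) / 2 = (2 * L - 1) / 2 + k * (2 * L - 1) / 2"
    by (simp add: field_simps)
  moreover have "loss L t = (2 * L - 1) / 2 + L / (2 * pi) * (- cos (pi * (2 * t + (2 * L - 1)) / L) * S)"
    using assms loss_eq[of L t] by (simp add: S_def)
  ultimately show ?thesis by linarith
qed

text \<open>
  The centre is at distance \<open>1/6\<close> from the crest.  For \<open>L = 1/2\<close> the value of the wave there is \<open>1/4\<close>,
  and \<open>\<delta>\<close> measures how far the phase has moved away from that of \<open>L = 1/2\<close>.
\<close>
lemma loss_ge_sixth:
  assumes "1/2 \<le> L" "L \<le> 2/3"
  shows "(2 * L - 1) * (21 / 25 * L - 17 / 100) \<le> loss L (2 / 3 - L / 2)"
proof -
  define \<delta> where "\<delta> = pi / 3 * (2 - 1 / L)"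
  have \<delta>: "0 \<le> \<delta>" "\<delta> \<le> pi / 2" using assms by (simp_all add: \<delta>_def field_simps)
  have "pi * (2 * (2 / 3 - L / 2) + (2 * L - 1)) / L = (2 * pi / 3 - \<delta>) + pi"
    using assms by (simp add: \<delta>_def field_simps)
  then have "- cos (pi * (2 * (2 / 3 - L / 2) + (2 * L - 1)) / L) = cos (2 * pi / 3 - \<delta>)" by (simp only: cos_periodic_pi minus_minus)
  also have "\<dots> = - cos \<delta> / 2 + sqrt 3 / 2 * sin \<delta>"
    by (simp add: cos_diff cos_120 sin_120)
  finally have c: "- cos (pi * (2 * (2 / 3 - L / 2) + (2 * L - 1)) / L) = - cos \<delta> / 2 + sqrt 3 / 2 * sin \<delta>" .
  have "17 / 10 \<le> sqrt 3" by (rule real_le_rsqrt) (simp add: power2_eq_square)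
  moreover have "2 / 3 * (2 - 1 / L) \<le> sin \<delta>"
    using sin_ge_chord[OF \<delta>] by (simp add: \<delta>_def)
  moreover have "L * (2 - 1 / L) = 2 * L - 1" "0 \<le> 2 - 1 / L" using assms by (simp_all add: field_simps)
  ultimately have 1: "17 / 10 / 2 * (2 / 3 * (2 - 1 / L)) \<le> sqrt 3 / 2 * sin \<delta>"
    by (intro mult_mono) simp_all
  have 2: "3 / 2 * (2 * L - 1) \<le> 2 - 1 / L"
    using assms mult_nonneg_nonneg[of "2 * L - 1" "2 - 3 * L"] by (simp add: field_simps)
  have 3: "17 / 10 * L - 17 / 20 \<le> sqrt 3 / 2 * sin \<delta>"
    using 1 mult_left_mono[OF 2, of "17 / 30"] by simp
  have "42 / 25 * L - 67 / 50 \<le> - cos \<delta> / 2 + sqrt 3 / 2 * sin \<delta>"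
  proof -
    define Y where "Y = sqrt 3 / 2 * sin \<delta>"
    have "- 1 / 2 \<le> - cos \<delta> / 2" by simp
    then show ?thesis using assms 3 unfolding Y_def[symmetric] by linarith
  qed
  then have "(2 * L - 1) * (1 + (42 / 25 * L - 67 / 50)) / 2 \<le> loss L (2 / 3 - L / 2)"
    using assms c by (intro loss_ge_of_cos_ge) auto
  then show ?thesis by (simp add: field_simps)
qed

text \<open>
  As for the distance \<open>1/6\<close>, with \<open>5/24\<close>: for \<open>L = 1/2\<close> the value of the wave is
  \<open>(1 - sqrt 3 / 2) / 2\<close>, slightly more than \<open>669 / 10000\<close>.
\<close>
lemma loss_ge_five_24:
  assumes "1/2 \<le> L" "L \<le> 7/12"
  shows "(2 * L - 1) * (669 / 10000 + 5 / 14 * (2 * L - 1)) \<le> loss L (17 / 24 - L / 2)"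
proof -
  define \<delta> where "\<delta> = 5 * pi / 12 * (2 - 1 / L)"
  have \<delta>: "0 \<le> \<delta>" "\<delta> \<le> pi / 2" using assms by (simp_all add: \<delta>_def field_simps)
  have "pi * (2 * (17 / 24 - L / 2) + (2 * L - 1)) / L = (pi - (pi / 6 + \<delta>)) + pi"
    using assms by (simp add: \<delta>_def field_simps)
  then have "- cos (pi * (2 * (17 / 24 - L / 2) + (2 * L - 1)) / L) = - cos (pi / 6 + \<delta>)" by (simp only: cos_periodic_pi minus_minus cos_pi_minus)
  also have "\<dots> = - (sqrt 3 / 2 * cos \<delta>) + sin \<delta> / 2"
    by (simp add: cos_add cos_30 sin_30)
  finally have c: "- cos (pi * (2 * (17 / 24 - L / 2) + (2 * L - 1)) / L) = - (sqrt 3 / 2 * cos \<delta>) + sin \<delta> / 2" .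
  define X where "X = sqrt 3 / 2 * cos \<delta>"
  have "sqrt 3 \<le> 17324 / 10000" by (rule real_le_lsqrt) (simp_all add: power2_eq_square)
  moreover have "sqrt 3 / 2 * cos \<delta> \<le> sqrt 3 / 2 * 1" by (intro mult_left_mono) auto
  moreover have "10 / 7 * (2 * L - 1) \<le> sin \<delta>"
  proof -
    have "12 / 7 * (2 * L - 1) \<le> 2 - 1 / L"
      using assms mult_nonneg_nonneg[of "2 * L - 1" "7 - 12 * L"] by (simp add: field_simps)
    moreover have "5 / 6 * (2 - 1 / L) \<le> sin \<delta>"
      using sin_ge_chord[OF \<delta>] by (simp add: \<delta>_def)
    ultimately show ?thesis using mult_left_mono[of "12 / 7 * (2 * L - 1)" "2 - 1 / L" "5 / 6"] by simp
  qed
  ultimately have "5 / 7 * (2 * L - 1) - 8662 / 10000 \<le> - (sqrt 3 / 2 * cos \<delta>) + sin \<delta> / 2"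
    unfolding X_def[symmetric] by linarith
  then have "(2 * L - 1) * (1 + (5 / 7 * (2 * L - 1) - 8662 / 10000)) / 2 \<le> loss L (17 / 24 - L / 2)"
    using assms c by (intro loss_ge_of_cos_ge) auto
  then show ?thesis by (simp add: field_simps)
qed

section \<open>A switch within one period\<close>

text \<open>
  Old wave minus new wave, as functions of the phase \<open>z = x - m\<close> with respect to the old index \<open>m\<close>.
\<close>
definition gap :: "real \<Rightarrow> real \<Rightarrow> real" where
  "gap L z = bump L z - bump L (z + (2 * L - 1))"

text \<open>
  What a switch at phase \<open>t\<close> costs within the period \<open>[-L, L]\<close>, compared with a switch at the end of the
  half-wave: on \<open>[t, L]\<close> the old wave is replaced by the new one, at the position \<open>x = \<nu> + z\<close>.
\<close>
definition level :: "real \<Rightarrow> real \<Rightarrow> real \<Rightarrow> real" where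
  "level L \<nu> t = integral {t..L} (\<lambda>z. gap L z / (\<nu> + z)\<^sup>2)"

text \<open>
  A switch before the whole half-wave loses no mass but moves the half-wave to the left by \<open>2 L - 1\<close>,
  where the weight \<open>1 / x\<^sup>2\<close> is larger.  This is the profit, the most that a switch can gain in one
  period.
\<close>
definition gain :: "real \<Rightarrow> real \<Rightarrow> real" where
  "gain L \<nu> = integral {0..L} (\<lambda>z. bump L z * (1 / (\<nu> + z - (2 * L - 1))\<^sup>2 - 1 / (\<nu> + z)\<^sup>2))"

lemma gap_nonneg:
  assumes "1/2 \<le> L" "L \<le> 1" "1 - L \<le> 2 * z" "z \<le> L" shows "0 \<le> gap L z"
  using bump_ge_shifted[of L z] assms by (simp add: gap_def)

lemma gap_nonpos:
  assumes "1/2 \<le> L" "L \<le> 1" "2 * z \<le> 1 - L" "-L \<le> z" shows "gap L z \<le> 0"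
  using bump_le_shifted[of L z] assms by (simp add: gap_def)

lemma continuous_on_gap [continuous_intros]:
  fixes f :: "real \<Rightarrow> real"
  shows "continuous_on S f \<Longrightarrow> continuous_on S (\<lambda>x. gap L (f x))"
  unfolding gap_def by (intro continuous_intros)

lemma integrable_gap_weight:
  "0 < \<nu> + a \<Longrightarrow> (\<lambda>z. gap L z / (\<nu> + z)\<^sup>2) integrable_on {a..b}"
  by (intro integrable_continuous_real continuous_intros continuous_on_gap[of _ "\<lambda>x. x"]) auto

lemma integrable_bump_weight:
  "0 < \<nu> + a \<Longrightarrow> (\<lambda>z. bump L z / (\<nu> + z)\<^sup>2) integrable_on {a..b}"
  by (intro integrable_continuous_real continuous_intros continuous_on_bump[of _ "\<lambda>x. x"]) auto

lemma level_split:
  assumes "0 < \<nu> + t" "t \<le> t'" "t' \<le> L"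
  shows "level L \<nu> t = integral {t..t'} (\<lambda>z. gap L z / (\<nu> + z)\<^sup>2) + level L \<nu> t'"
  unfolding level_def using assms
  by (intro Henstock_Kurzweil_Integration.integral_combine[symmetric] integrable_gap_weight) auto

lemma level_mono:
  assumes "1/2 \<le> L" "L \<le> 1" "-L \<le> t" "t \<le> t'" "2 * t' \<le> 1 - L" "0 < \<nu> + t"
  shows "level L \<nu> t \<le> level L \<nu> t'"
proof -
  have "0 \<le> integral {t..t'} (\<lambda>z. - (gap L z / (\<nu> + z)\<^sup>2))"
    using assms by (intro integral_nonneg integrable_neg integrable_gap_weight)
      (auto simp: divide_nonpos_nonneg gap_nonpos)
  moreover have "t' \<le> L" using assms by linarith
  ultimately show ?thesis using level_split[of \<nu> t t' L] assms by simp
qed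

lemma level_antimono:
  assumes "1/2 \<le> L" "L \<le> 1" "1 - L \<le> 2 * t" "t \<le> t'" "t' \<le> L" "0 < \<nu> + t"
  shows "level L \<nu> t' \<le> level L \<nu> t"
proof -
  have "0 \<le> integral {t..t'} (\<lambda>z. gap L z / (\<nu> + z)\<^sup>2)"
    using assms by (intro integral_nonneg integrable_gap_weight) (auto intro!: divide_nonneg_nonneg gap_nonneg)
  then show ?thesis using level_split[of \<nu> t t' L] assms by simp
qed

lemma level_at_L: "level L \<nu> L = 0"
  by (simp add: level_def)

lemma level_nonneg:
  assumes "1/2 \<le> L" "L \<le> 1" "1 - L \<le> 2 * t" "t \<le> L" "0 < \<nu> + t"
  shows "0 \<le> level L \<nu> t"
  using level_antimono[of L t L \<nu>] assms by (simp add: level_at_L)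

text \<open>
  On \<open>[1 - L, L]\<close> the new wave vanishes, so that close to \<open>L\<close> something is lost.
\<close>
lemma level_pos:
  assumes "1/2 < L" "L \<le> 1" "1 - L \<le> 2 * t" "t < L" "0 < \<nu> + t"
  shows "0 < level L \<nu> t"
proof -
  define z0 where "z0 = max t (1 - L)"
  have z0: "t \<le> z0" "1 - L \<le> z0" "z0 < L" using assms by (auto simp: z0_def)
  have "continuous_on {z0..L} (\<lambda>z. gap L z / (\<nu> + z)\<^sup>2)"
    using assms z0 by (intro continuous_intros continuous_on_gap[of _ "\<lambda>x. x"]) auto
  moreover have "0 < gap L z / (\<nu> + z)\<^sup>2" if "z0 < z" "z < L" for z
  proof -
    have "bump L (z + (2 * L - 1)) = 0" using that z0 assms by (intro bump_right_zero) auto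
    moreover have "0 < bump L z" using that z0 assms by (intro bump_pos) auto
    ultimately show ?thesis using that z0 assms by (simp add: gap_def)
  qed
  ultimately have "integral {z0..L} (\<lambda>_. 0) < integral {z0..L} (\<lambda>z. gap L z / (\<nu> + z)\<^sup>2)"
    using z0 integral_less[of z0 L "\<lambda>_. 0" "\<lambda>z. gap L z / (\<nu> + z)\<^sup>2"] by (auto simp: box_real)
  then have "0 < level L \<nu> z0" by (simp add: level_def)
  also have "\<dots> \<le> level L \<nu> t" using assms z0 by (intro level_antimono) auto
  finally show ?thesis .
qed

text \<open>
  The integral of the new wave is moved to the phase of that wave itself, which vanishes beyond \<open>L\<close>.
\<close>
lemma level_eq:
  assumes "1/2 \<le> L" "L \<le> 1" "-L \<le> t" "t \<le> L" "0 < \<nu> + t"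
  shows "level L \<nu> t = integral {t..L} (\<lambda>z. bump L z / (\<nu> + z)\<^sup>2)
      - integral {t + (2 * L - 1)..L} (\<lambda>z. bump L z / (\<nu> + z - (2 * L - 1))\<^sup>2)"
proof -
  let ?s = "2 * L - 1"
  have "level L \<nu> t = integral {t..L} (\<lambda>z. bump L z / (\<nu> + z)\<^sup>2) - integral {t..L} (\<lambda>z. bump L (z + ?s) / (\<nu> + z)\<^sup>2)"
    unfolding level_def gap_def diff_divide_distrib using assms
    by (intro Henstock_Kurzweil_Integration.integral_diff integrable_bump_weight)
       (auto intro!: integrable_continuous_real continuous_intros)
  also have "integral {t..L} (\<lambda>z. bump L (z + ?s) / (\<nu> + z)\<^sup>2) = integral {t + ?s..L + ?s} (\<lambda>z. bump L z / (\<nu> + z - ?s)\<^sup>2)"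
    by (subst integral_shift_Icc_real[symmetric]) (simp add: o_def add_ac)
  also have "\<dots> = integral {t + ?s..L} (\<lambda>z. bump L z / (\<nu> + z - ?s)\<^sup>2)"
  proof (cases "t + ?s \<le> L")
    case True
    have int: "(\<lambda>z. bump L z / (\<nu> + z - ?s)\<^sup>2) integrable_on {t + ?s..L + ?s}"
      using integrable_bump_weight[of "\<nu> - ?s" "t + ?s" L "L + ?s"] assms by (simp add: algebra_simps)
    have "integral {L..L + ?s} (\<lambda>z. bump L z / (\<nu> + z - ?s)\<^sup>2) = integral {L..L + ?s} (\<lambda>_. 0)"
      using assms by (intro integral_cong) (auto simp: bump_right_zero)
    then show ?thesis
      using Henstock_Kurzweil_Integration.integral_combine[OF True _ int] assms by simp
  next
    case False
    have "integral {t + ?s..L + ?s} (\<lambda>z. bump L z / (\<nu> + z - ?s)\<^sup>2) = integral {t + ?s..L + ?s} (\<lambda>_. 0)"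
      using assms False by (intro integral_cong) (auto simp: bump_right_zero)
    then show ?thesis using False by simp
  qed
  finally show ?thesis .
qed

lemma gap_integrable: "gap L integrable_on {a..b}"
  by (intro integrable_continuous_real continuous_on_gap[of _ "\<lambda>x. x", simplified])

lemma loss_eq_integral_gap:
  assumes "1/2 \<le> L" "L \<le> 1" "-L \<le> t" "t \<le> L"
  shows "loss L t = integral {t..L} (gap L)"
proof -
  let ?s = "2 * L - 1"
  have "integral {t..L} (gap L) = integral {t..L} (bump L) - integral {t..L} (\<lambda>z. bump L (z + ?s))"
    unfolding gap_def
    by (intro Henstock_Kurzweil_Integration.integral_diff bump_integrable integrable_continuous_real continuous_intros)
  also have "integral {t..L} (\<lambda>z. bump L (z + ?s)) = integral {t + ?s..L + ?s} (bump L)"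
    by (subst integral_shift_Icc_real[symmetric]) (simp add: o_def add_ac)
  also have "\<dots> = tail_mass L (t + ?s)"
  proof (cases "t + ?s \<le> L")
    case True
    have "integral {L..L + ?s} (bump L) = integral {L..L + ?s} (\<lambda>_. 0)"
      using assms by (intro integral_cong) (auto simp: bump_right_zero)
    then show ?thesis
      using Henstock_Kurzweil_Integration.integral_combine[OF True _ bump_integrable, of "L + ?s" L] assms by (simp add: tail_mass_def)
  next
    case False
    have "integral {t + ?s..L + ?s} (bump L) = integral {t + ?s..L + ?s} (\<lambda>_. 0)"
      using assms False by (intro integral_cong) (auto simp: bump_right_zero)
    then show ?thesis using False by (simp add: tail_mass_def)
  qed
  finally show ?thesis by (simp add: loss_def tail_mass_def)
qed

lemma loss_mono:
  assumes "1/2 \<le> L" "L \<le> 1" "-L \<le> t" "t \<le> t'" "2 * t' \<le> 1 - L"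
  shows "loss L t \<le> loss L t'"
proof -
  have "t' \<le> L" using assms by linarith
  then have "integral {t..t'} (gap L) + integral {t'..L} (gap L) = integral {t..L} (gap L)"
    using assms by (intro Henstock_Kurzweil_Integration.integral_combine gap_integrable) auto
  moreover have "0 \<le> integral {t..t'} (\<lambda>z. - gap L z)"
    using assms by (intro integral_nonneg integrable_neg gap_integrable) (auto simp: gap_nonpos)
  ultimately show ?thesis using \<open>t' \<le> L\<close> assms by (simp add: loss_eq_integral_gap)
qed

text \<open>
  To the right of the crossing point the gap is nonnegative, so the weight can be replaced by its least
  value.
\<close>
lemma level_ge_weight_loss:
  assumes "1/2 \<le> L" "L \<le> 1" "1 - L \<le> 2 * t" "t \<le> L" "0 < \<nu> + t"
  shows "loss L t / (\<nu> + L)\<^sup>2 \<le> level L \<nu> t"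
proof -
  have "loss L t / (\<nu> + L)\<^sup>2 = integral {t..L} (\<lambda>z. gap L z / (\<nu> + L)\<^sup>2)"
    using assms by (simp add: loss_eq_integral_gap)
  also have "\<dots> \<le> level L \<nu> t"
    unfolding level_def using assms
    by (intro integral_le integrable_gap_weight integrable_on_divide gap_integrable)
       (auto intro!: divide_left_mono power_mono gap_nonneg)
  finally show ?thesis .
qed

lemma gain_integrable:
  assumes "1/2 \<le> L" "L \<le> 1" "2 * L - 1 < \<nu> + a"
  shows "(\<lambda>z. bump L z * (1 / (\<nu> + z - (2 * L - 1))\<^sup>2 - 1 / (\<nu> + z)\<^sup>2)) integrable_on {a..b}"
  using assms
  by (intro integrable_continuous_real continuous_intros continuous_on_bump[of _ "\<lambda>x. x"]) auto

lemma weight_gap_antimono: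
  fixes s :: real
  assumes "0 \<le> s" "s < y" "y \<le> y'"
  shows "1 / (y' - s)\<^sup>2 - 1 / y'\<^sup>2 \<le> 1 / (y - s)\<^sup>2 - 1 / y\<^sup>2"
proof -
  have frac: "1 / d\<^sup>2 - 1 / e\<^sup>2 = (e - d) * (1 / (d * e\<^sup>2) + 1 / (d\<^sup>2 * e))" if "d \<noteq> 0" "e \<noteq> 0" for d e :: real
    using that by (simp add: field_simps power2_eq_square)
  have eq: "1 / (y - s)\<^sup>2 - 1 / y\<^sup>2 = s * (1 / ((y - s) * y\<^sup>2) + 1 / ((y - s)\<^sup>2 * y))" if "s < y" for y
    using frac[of "y - s" y] that assms by simp
  show ?thesis
    using assms unfolding eq[OF assms(2)] eq[OF less_le_trans[OF assms(2,3)]]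
    by (intro mult_left_mono add_mono divide_left_mono mult_mono power_mono mult_pos_pos) auto
qed

lemma weight_gap_nonneg:
  fixes s :: real
  assumes "0 \<le> s" "s < y"
  shows "0 \<le> 1 / (y - s)\<^sup>2 - 1 / y\<^sup>2"
  using assms by (auto intro!: divide_left_mono power_mono)

text \<open>
  The stretch up to \<open>t + (2 L - 1)\<close> is lost, the rest of the half-wave is moved to a place of larger
  weight.
\<close>
lemma level_eq_loss_gain:
  assumes "1/2 \<le> L" "L \<le> 1" "-L \<le> t" "t + (2 * L - 1) \<le> L" "0 < \<nu> + t"
  shows "level L \<nu> t = integral {t..t + (2 * L - 1)} (\<lambda>z. bump L z / (\<nu> + z)\<^sup>2)
      - integral {t + (2 * L - 1)..L} (\<lambda>z. bump L z * (1 / (\<nu> + z - (2 * L - 1))\<^sup>2 - 1 / (\<nu> + z)\<^sup>2))"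
proof -
  let ?s = "2 * L - 1"
  have 1: "integral {t..L} (\<lambda>z. bump L z / (\<nu> + z)\<^sup>2) = integral {t..t + ?s} (\<lambda>z. bump L z / (\<nu> + z)\<^sup>2)
      + integral {t + ?s..L} (\<lambda>z. bump L z / (\<nu> + z)\<^sup>2)"
    using assms by (intro Henstock_Kurzweil_Integration.integral_combine[symmetric] integrable_bump_weight) auto
  have "(\<lambda>z. bump L z / (\<nu> - ?s + z)\<^sup>2) integrable_on {t + ?s..L}"
    using assms by (intro integrable_bump_weight) auto
  then have 2: "(\<lambda>z. bump L z / (\<nu> + z - ?s)\<^sup>2) integrable_on {t + ?s..L}"
    by (simp add: algebra_simps)
  have 3: "(\<lambda>z. bump L z / (\<nu> + z)\<^sup>2) integrable_on {t + ?s..L}"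
    using assms by (intro integrable_bump_weight) auto
  have "integral {t + ?s..L} (\<lambda>z. bump L z * (1 / (\<nu> + z - ?s)\<^sup>2 - 1 / (\<nu> + z)\<^sup>2))
     = integral {t + ?s..L} (\<lambda>z. bump L z / (\<nu> + z - ?s)\<^sup>2) - integral {t + ?s..L} (\<lambda>z. bump L z / (\<nu> + z)\<^sup>2)"
    unfolding right_diff_distrib using 2 3
    by (subst Henstock_Kurzweil_Integration.integral_diff[symmetric]) auto
  then show ?thesis using level_eq[of L t \<nu>] 1 assms by simp
qed

lemma weighted_loss_ge:
  assumes "1/2 \<le> L" "0 < \<nu> + t" "t + (2 * L - 1) \<le> L"
  shows "loss L t / (\<nu> + t + (2 * L - 1))\<^sup>2 \<le> integral {t..t + (2 * L - 1)} (\<lambda>z. bump L z / (\<nu> + z)\<^sup>2)"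
proof -
  let ?s = "2 * L - 1"
  have "integral {t..t + ?s} (bump L) + integral {t + ?s..L} (bump L) = integral {t..L} (bump L)"
    using assms by (intro Henstock_Kurzweil_Integration.integral_combine bump_integrable) auto
  then have "loss L t / (\<nu> + t + ?s)\<^sup>2 = integral {t..t + ?s} (\<lambda>z. bump L z / (\<nu> + t + ?s)\<^sup>2)"
    by (simp add: loss_def tail_mass_def)
  also have "\<dots> \<le> integral {t..t + ?s} (\<lambda>z. bump L z / (\<nu> + z)\<^sup>2)"
    using assms
    by (intro integral_le integrable_on_divide bump_integrable integrable_bump_weight)
       (auto intro!: divide_left_mono power_mono simp: bump_nonneg)
  finally show ?thesis .
qed

text \<open>
  At most \<open>L / 2 - l\<close> remains to be moved.  The loss is weighted at the right end of the omitted stretch,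
  and the gain is overestimated by moving the whole rest across that stretch.
\<close>
lemma level_ge_half_minus:
  assumes "1/2 \<le> L" "L \<le> 1" "-L \<le> t" "t + (2 * L - 1) \<le> L" "0 < \<nu> + t"
    and l: "l \<le> loss L t"
  shows "L / 2 / (\<nu> + t + (2 * L - 1))\<^sup>2 - (L / 2 - l) / (\<nu> + t)\<^sup>2 \<le> level L \<nu> t"
proof -
  let ?s = "2 * L - 1"
  define w1 where "w1 = 1 / (\<nu> + t)\<^sup>2"
  define w2 where "w2 = 1 / (\<nu> + t + ?s)\<^sup>2"
  define h where "h = L / 2"
  have w: "0 \<le> w1 - w2" "0 \<le> w1"
    using weight_gap_nonneg[of ?s "\<nu> + t + ?s"] assms by (simp_all add: w1_def w2_def)
  have "integral {t + ?s..L} (\<lambda>z. bump L z * (1 / (\<nu> + z - ?s)\<^sup>2 - 1 / (\<nu> + z)\<^sup>2))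
      \<le> integral {t + ?s..L} (\<lambda>z. bump L z * (w1 - w2))"
  proof (intro integral_le gain_integrable integrable_on_mult_left bump_integrable mult_left_mono bump_nonneg)
    fix z assume "z \<in> {t + ?s..L}"
    then show "1 / (\<nu> + z - ?s)\<^sup>2 - 1 / (\<nu> + z)\<^sup>2 \<le> w1 - w2"
      using weight_gap_antimono[of ?s "\<nu> + t + ?s" "\<nu> + z"] assms by (simp add: w1_def w2_def)
  qed (use assms in auto)
  also have "\<dots> = tail_mass L (t + ?s) * (w1 - w2)" by (simp add: tail_mass_def)
  finally have "level L \<nu> t \<ge> loss L t * w2 - tail_mass L (t + ?s) * (w1 - w2)"
    using level_eq_loss_gain[of L t \<nu>] weighted_loss_ge[of L \<nu> t] assms by (simp add: w2_def)
  moreover have "tail_mass L (t + ?s) * (w1 - w2) \<le> (L / 2 - loss L t) * (w1 - w2)"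
    using tail_mass_le[of L t] assms w by (intro mult_right_mono) (auto simp: loss_def)
  moreover have "(L / 2 - loss L t) * w1 \<le> (L / 2 - l) * w1"
    using w l by (intro mult_right_mono) auto
  ultimately have "h * w2 - (h - l) * w1 \<le> level L \<nu> t"
    unfolding h_def[symmetric] by (simp add: algebra_simps)
  then have "L / 2 * w2 - (L / 2 - l) * w1 \<le> level L \<nu> t" by (simp only: h_def)
  then show ?thesis by (simp add: w1_def w2_def)
qed

lemma level_ge_loss_minus_gain:
  assumes "1/2 \<le> L" "L \<le> 1" "-L \<le> t" "t + (2 * L - 1) \<le> L" "0 < \<nu> + t" "L < \<nu>" "0 \<le> t + (2 * L - 1)"
  shows "loss L t / (\<nu> + t + (2 * L - 1))\<^sup>2 - gain L \<nu> \<le> level L \<nu> t"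
proof -
  let ?s = "2 * L - 1"
  have "integral {t + ?s..L} (\<lambda>z. bump L z * (1 / (\<nu> + z - ?s)\<^sup>2 - 1 / (\<nu> + z)\<^sup>2)) \<le> gain L \<nu>"
    unfolding gain_def using assms
    by (intro integral_subset_le gain_integrable)
       (auto intro!: mult_nonneg_nonneg bump_nonneg weight_gap_nonneg)
  then show ?thesis
    using level_eq_loss_gain[of L t \<nu>] weighted_loss_ge[of L \<nu> t] assms by simp
qed

text \<open>
  For \<open>t\<close> below the crossing point the level is increasing in \<open>t\<close>, so its least value is at \<open>t = -L\<close>,
  where it is the full gain with the opposite sign.
\<close>
lemma level_ge_minus_gain:
  assumes "1/2 \<le> L" "L \<le> 1" "-L \<le> t" "t \<le> L" "L < \<nu>"
  shows "- gain L \<nu> \<le> level L \<nu> t"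
proof -
  let ?s = "2 * L - 1"
  have "integral {-L..-L + ?s} (\<lambda>z. bump L z / (\<nu> + z)\<^sup>2) = integral {-L..-L + ?s} (\<lambda>_. 0)"
    using assms by (intro integral_cong) (auto simp: bump_left_zero)
  moreover have "integral {-L + ?s..L} (\<lambda>z. bump L z * (1 / (\<nu> + z - ?s)\<^sup>2 - 1 / (\<nu> + z)\<^sup>2)) = gain L \<nu>"
  proof -
    have "integral {-L + ?s..0} (\<lambda>z. bump L z * (1 / (\<nu> + z - ?s)\<^sup>2 - 1 / (\<nu> + z)\<^sup>2)) = integral {-L + ?s..0} (\<lambda>_. 0)"
      using assms by (intro integral_cong) (auto simp: bump_left_zero)
    moreover have "integral {-L + ?s..0} (\<lambda>z. bump L z * (1 / (\<nu> + z - ?s)\<^sup>2 - 1 / (\<nu> + z)\<^sup>2)) + gain L \<nu>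
      = integral {-L + ?s..L} (\<lambda>z. bump L z * (1 / (\<nu> + z - ?s)\<^sup>2 - 1 / (\<nu> + z)\<^sup>2))"
      unfolding gain_def using assms
      by (intro Henstock_Kurzweil_Integration.integral_combine gain_integrable) auto
    ultimately show ?thesis by simp
  qed
  ultimately have eq: "level L \<nu> (-L) = - gain L \<nu>"
    using level_eq_loss_gain[of L "-L" \<nu>] assms by simp
  show ?thesis
  proof (cases "2 * t \<le> 1 - L")
    case True
    then show ?thesis using level_mono[of L "-L" t \<nu>] assms eq by simp
  next
    case False
    have "0 \<le> gain L \<nu>" unfolding gain_def using assms
      by (intro integral_nonneg gain_integrable)
         (auto intro!: mult_nonneg_nonneg bump_nonneg weight_gap_nonneg)
    moreover have "0 \<le> level L \<nu> t" using False assms by (intro level_nonneg) auto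
    ultimately show ?thesis by simp
  qed
qed

text \<open>
  The right-hand side is the integral of \<open>1/2\<close> times the weight.  As \<open>bump = (1 - cos (k z)) / 2\<close> with
  \<open>k = 2 pi / L\<close>, the claim is that the cosine coefficient of the convex function \<open>1 / (c + z)\<^sup>2\<close> over a
  full period is nonnegative.  Integrating by parts twice leaves the integral of
  \<open>(1 - cos (k z)) / k\<^sup>2\<close> times the second derivative; \<open>Q\<close> is the resulting antiderivative.
\<close>
lemma bump_weight_le:
  assumes "1/2 \<le> L" "0 < c"
  shows "integral {0..L} (\<lambda>z. bump L z / (c + z)\<^sup>2) \<le> L / 2 / (c * (c + L))"
proof -
  define k where "k = 2 * pi / L"
  have k: "0 < k" "k * L = 2 * pi" using assms by (simp_all add: k_def)
  define i where "i z = inverse (c + z)" for z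
  define S where "S z = sin (k * z) / k" for z
  define C where "C z = (1 - cos (k * z)) / k\<^sup>2" for z
  define Q where "Q z = - (1 / 2) * i z - 1 / 2 * (S z * (i z * i z) + 2 * (C z * (i z * i z * i z)))" for z
  define q where "q z = bump L z / (c + z)\<^sup>2 + 3 * (C z * (i z * i z * i z * i z))" for z
  have dS: "(S has_real_derivative cos (k * z)) (at z)" for z
    unfolding S_def using k by (auto intro!: derivative_eq_intros)
  have dC: "(C has_real_derivative S z) (at z)" for z
    unfolding C_def S_def using k by (auto intro!: derivative_eq_intros simp: power2_eq_square)
  have C: "0 \<le> C z" for z by (simp add: C_def)
  have q: "(q has_integral (Q L - Q 0)) {0..L}"
  proof (rule fundamental_theorem_of_calculus)
    fix z assume z: "z \<in> {0..L}"
    have cz: "0 < c + z" using z assms by auto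
    have b: "bump L z = 1 / 2 - cos (k * z) / 2"
    proof -
      have kz: "k * z = 2 * (pi * z / L)" by (simp add: k_def)
      have "cos (k * z) = 1 - 2 * bump L z"
        using bump_eq_sin[of z L] z assms unfolding kz cos_double_sin by simp
      then show ?thesis by linarith
    qed
    have di: "(i has_real_derivative - (i z * i z)) (at z)"
      unfolding i_def using cz by (auto intro!: derivative_eq_intros)
    have w: "bump L z / (c + z)\<^sup>2 = (1 / 2 - 1 / 2 * cos (k * z)) * (i z * i z)"
      unfolding b i_def by (simp add: inverse_eq_divide power2_eq_square)
    note dii = DERIV_mult[OF di di]
    note diii = DERIV_mult[OF dii di]
    note dQ = DERIV_diff[OF DERIV_cmult[OF di, of "- (1 / 2)"]
        DERIV_cmult[OF DERIV_add[OF DERIV_mult[OF dS dii] DERIV_cmult[OF DERIV_mult[OF dC diii], of 2]], of "1 / 2"]]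
    have "(Q has_real_derivative q z) (at z)"
      unfolding Q_def by (rule DERIV_cong[OF dQ]) (simp add: q_def w algebra_simps)
    then show "(Q has_vector_derivative q z) (at z within {0..L})"
      by (simp add: has_real_derivative_iff_has_vector_derivative has_vector_derivative_at_within)
  qed (use assms in auto)
  have "S L = 0" "S 0 = 0" "C L = 0" "C 0 = 0" by (simp_all add: S_def C_def k)
  then have "Q L - Q 0 = L / 2 / (c * (c + L))"
    using assms by (simp add: Q_def i_def field_simps)
  moreover have "integral {0..L} (\<lambda>z. bump L z / (c + z)\<^sup>2) \<le> integral {0..L} q"
  proof (intro integral_le integrable_bump_weight has_integral_integrable[OF q])
    fix z assume "z \<in> {0..L}"
    then have "0 \<le> i z" using assms by (simp add: i_def)
    then show "bump L z / (c + z)\<^sup>2 \<le> q z" using C[of z] by (simp add: q_def)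
  qed (use assms in auto)
  ultimately show ?thesis using q by (simp add: integral_unique)
qed

text \<open>
  The intervals \<open>[y - (2 L - 1), y]\<close> and \<open>[y - L, y - L + 1]\<close> have the same centre \<open>c\<close>, and for the
  weight \<open>1 / x\<^sup>2\<close> the difference quotient over a symmetric interval grows in absolute value with its length.
\<close>
lemma weight_gap_le:
  fixes L y :: real
  assumes "1/2 \<le> L" "L \<le> 1" "L < y"
  shows "1 / (y - (2 * L - 1))\<^sup>2 - 1 / y\<^sup>2 \<le> (2 * L - 1) * (1 / (y - L)\<^sup>2 - 1 / (y - L + 1)\<^sup>2)"
proof -
  define c where "c = y - L + 1 / 2"
  define r where "r = L - 1 / 2"
  have c: "1 / 2 < c" "0 \<le> r" "r \<le> 1 / 2" using assms by (simp_all add: c_def r_def)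
  have gen: "1 / (c - u)\<^sup>2 - 1 / (c + u)\<^sup>2 = 4 * c * u / (c\<^sup>2 - u\<^sup>2)\<^sup>2" if "0 \<le> u" "u \<le> 1 / 2" for u
  proof -
    have *: "1 / d\<^sup>2 - 1 / e\<^sup>2 = (e\<^sup>2 - d\<^sup>2) / (d\<^sup>2 * e\<^sup>2)" if "d \<noteq> 0" "e \<noteq> 0" for d e :: real
      using that by (simp add: field_simps)
    have "(c\<^sup>2 - u\<^sup>2)\<^sup>2 = (c - u)\<^sup>2 * (c + u)\<^sup>2" "(c + u)\<^sup>2 - (c - u)\<^sup>2 = 4 * c * u"
      by algebra+
    then show ?thesis using *[of "c - u" "c + u"] c that by simp
  qed
  have "4 * c * r / (c\<^sup>2 - r\<^sup>2)\<^sup>2 \<le> 4 * c * r / (c\<^sup>2 - (1/2)\<^sup>2)\<^sup>2"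
  proof (intro divide_left_mono power_mono mult_pos_pos)
    have "r\<^sup>2 \<le> (1/2)\<^sup>2" using c by (intro power_mono) auto
    moreover have "(1/2)\<^sup>2 < c\<^sup>2" using c by (intro power_strict_mono) auto
    ultimately show "c\<^sup>2 - (1/2)\<^sup>2 \<le> c\<^sup>2 - r\<^sup>2" "0 \<le> c\<^sup>2 - (1/2)\<^sup>2"
      "0 < (c\<^sup>2 - r\<^sup>2)\<^sup>2" "0 < (c\<^sup>2 - (1/2)\<^sup>2)\<^sup>2" by auto
  qed (use c in auto)
  also have "\<dots> = 2 * r * (4 * c * (1/2) / (c\<^sup>2 - (1/2)\<^sup>2)\<^sup>2)" by simp
  finally have "1 / (c - r)\<^sup>2 - 1 / (c + r)\<^sup>2 \<le> 2 * r * (1 / (c - 1/2)\<^sup>2 - 1 / (c + 1/2)\<^sup>2)"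
    using gen[of r] gen[of "1/2"] c by simp
  then show ?thesis by (simp add: c_def r_def algebra_simps)
qed

text \<open>
  The estimate of a single gain by an interval of length \<open>1\<close> makes the sum telescope.
\<close>
lemma sum_gain_le:
  assumes "1/2 \<le> L" "L \<le> 1" "L < \<nu>"
  shows "(\<Sum>j<n. gain L (\<nu> + real j)) \<le> (2 * L - 1) * (L / 2) / (\<nu> * (\<nu> - L))"
proof -
  let ?s = "2 * L - 1"
  define \<Phi> where "\<Phi> \<nu> = ?s * integral {0..L} (\<lambda>z. bump L z / (\<nu> - L + z)\<^sup>2)" for \<nu>
  have \<Phi>0: "0 \<le> \<Phi> x" if "L < x" for x
    unfolding \<Phi>_def using assms that
    by (intro mult_nonneg_nonneg integral_nonneg integrable_bump_weight) (auto simp: bump_nonneg)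
  have step: "gain L x \<le> \<Phi> x - \<Phi> (x + 1)" if x: "L < x" for x
  proof -
    have int: "(\<lambda>z. bump L z / (x - L + z)\<^sup>2) integrable_on {0..L}" "(\<lambda>z. bump L z / (x + 1 - L + z)\<^sup>2) integrable_on {0..L}"
      using x by (intro integrable_bump_weight; simp)+
    have "\<Phi> x - \<Phi> (x + 1) = ?s * integral {0..L} (\<lambda>z. bump L z / (x - L + z)\<^sup>2 - bump L z / (x + 1 - L + z)\<^sup>2)"
      unfolding \<Phi>_def using int by (simp add: Henstock_Kurzweil_Integration.integral_diff right_diff_distrib)
    also have "\<dots> = integral {0..L} (\<lambda>z. ?s * (bump L z / (x - L + z)\<^sup>2 - bump L z / (x + 1 - L + z)\<^sup>2))"
      by simp
    also have "gain L x \<le> \<dots>" unfolding gain_def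
    proof (intro integral_le gain_integrable integrable_on_mult_right Henstock_Kurzweil_Integration.integrable_diff int)
      fix z assume z: "z \<in> {0..L}"
      have "bump L z * (1 / (x + z - ?s)\<^sup>2 - 1 / (x + z)\<^sup>2) \<le> bump L z * (?s * (1 / (x + z - L)\<^sup>2 - 1 / (x + z - L + 1)\<^sup>2))"
        using weight_gap_le[of L "x + z"] x z assms by (intro mult_left_mono bump_nonneg) auto
      also have "\<dots> = ?s * (bump L z / (x - L + z)\<^sup>2 - bump L z / (x + 1 - L + z)\<^sup>2)"
        by (simp add: algebra_simps)
      finally show "bump L z * (1 / (x + z - ?s)\<^sup>2 - 1 / (x + z)\<^sup>2) \<le> \<dots>" .
    qed (use assms x in auto)
    finally show ?thesis .
  qed
  have "(\<Sum>j<n. gain L (\<nu> + real j)) \<le> \<Phi> \<nu> - \<Phi> (\<nu> + real n)"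
  proof (induction n)
    case (Suc n)
    then show ?case using step[of "\<nu> + real n"] assms by (simp add: add_ac)
  qed simp
  also have "\<dots> \<le> \<Phi> \<nu>" using \<Phi>0[of "\<nu> + real n"] assms by simp
  also have "\<dots> \<le> ?s * (L / 2 / ((\<nu> - L) * (\<nu> - L + L)))"
    unfolding \<Phi>_def using assms by (intro mult_left_mono bump_weight_le) auto
  finally show ?thesis by (simp add: ac_simps)
qed

section \<open>Polynomial inequalities\<close>

text \<open>
  The inequalities of this section are polynomial in \<open>L\<close> and a second variable.  Each is certified by
  expanding the difference of the two sides, less a positive constant, in the Bernstein basis in
  \<open>a\<close> and \<open>b = 1 - a\<close> of the interval of \<open>L\<close>: all coefficients come out nonnegative.  The second variable
  enters through powers of \<open>r\<close>, its distance from the left end of an infinite interval, or through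
  \<open>c\<close> and \<open>d = 1 - c\<close> for the bounded interval \<open>[0, 1/2]\<close>.
\<close>
lemma poly_sixth:
  fixes L x :: real
  assumes "1/2 \<le> L" "L \<le> 2/3" "1 \<le> x"
  shows "L / 2 * (x + L)\<^sup>2 < (21/25 * L - 17/100) * ((x + 1) * (x + 1 - L))"
proof -
  obtain a b where ab: "0 \<le> a" "0 \<le> b" "b = 1 - a" "L = 1/2 + a * (1/6)"
    using that[of "6 * L - 3" "4 - 6 * L"] assms by (simp add: field_simps)
  obtain r where r: "0 \<le> r" "x = 1 + r" using that[of "x - 1"] assms by simp
  have "10800 * ((21/25 * L - 17/100) * ((x + 1) * (x + 1 - L)) - (L / 2 * (x + L)\<^sup>2) - 1/10) =
       (945 * b^3 + 3096 * a * b^2 + 2328 * a^2 * b + 152 * a^3)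
       + (1350 * b^3 + 5292 * a * b^2 + 5982 * a^2 * b + 2040 * a^3) * r
       + (612 * a * b^2 + 1224 * a^2 * b + 612 * a^3) * r^2"
    unfolding ab(3,4) r(2) by (simp add: field_simps eval_nat_numeral)
  also have "0 \<le> \<dots>"
    using ab r by (intro add_nonneg_nonneg mult_nonneg_nonneg zero_le_power) simp_all
  finally show ?thesis by simp
qed

lemma poly_eighth:
  fixes L x :: real
  assumes "1/2 \<le> L" "L \<le> 2/3" "2 \<le> x"
  shows "L * (x + 3/2 * L - 5/8) * (x + 3/8 - L/2)\<^sup>2 < (x - L/2 - 5/8) * ((x + 1) * (x + 1 - L))"
proof -
  obtain a b where ab: "0 \<le> a" "0 \<le> b" "b = 1 - a" "L = 1/2 + a * (1/6)"
    using that[of "6 * L - 3" "4 - 6 * L"] assms by (simp add: field_simps)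
  obtain r where r: "0 \<le> r" "x = 2 + r" using that[of "x - 2"] assms by simp
  have "27648 * ((x - L/2 - 5/8) * ((x + 1) * (x + 1 - L)) - (L * (x + 3/2 * L - 5/8) * (x + 3/8 - L/2)\<^sup>2) - 1/2) =
       (86805 * b^4 + 264969 * a * b^3 + 274515 * a^2 * b^2 + 101659 * a^3 * b + 5300 * a^4)
       + (191160 * b^4 + 665640 * a * b^3 + 849192 * a^2 * b^2 + 466264 * a^3 * b + 91552 * a^4) * r
       + (95040 * b^4 + 342720 * a * b^3 + 457536 * a^2 * b^2 + 267072 * a^3 * b + 57216 * a^4) * r^2
       + (13824 * b^4 + 50688 * a * b^3 + 69120 * a^2 * b^2 + 41472 * a^3 * b + 9216 * a^4) * r^3"
    unfolding ab(3,4) r(2) by (simp add: field_simps eval_nat_numeral)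
  also have "0 \<le> \<dots>"
    using ab r by (intro add_nonneg_nonneg mult_nonneg_nonneg zero_le_power) simp_all
  finally show ?thesis by simp
qed

lemma poly_twelfth:
  fixes L :: real
  assumes "1/2 \<le> L" "L \<le> 5/9"
  shows "L * (5/12 + 3/2 * L) * (17/12 - L/2)\<^sup>2 < (13/20 * (5/12 + 3/2 * L) - L) * (4 * (2 - L))"
proof -
  obtain a b where ab: "0 \<le> a" "0 \<le> b" "b = 1 - a" "L = 1/2 + a * (1/18)"
    using that[of "18 * L - 9" "10 - 18 * L"] assms by (simp add: field_simps)
  have "1399680 * ((13/20 * (5/12 + 3/2 * L) - L) * (4 * (2 - L)) - (L * (5/12 + 3/2 * L) * (17/12 - L/2)\<^sup>2) - 1/2) =
       (358344 * b^4 + 1191420 * a * b^3 + 1424838 * a^2 * b^2 + 709097 * a^3 * b + 117330 * a^4)"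
    unfolding ab(3,4) by (simp add: field_simps eval_nat_numeral)
  also have "0 \<le> \<dots>"
    using ab by (intro add_nonneg_nonneg mult_nonneg_nonneg zero_le_power) simp_all
  finally show ?thesis by simp
qed

lemma poly_five_24_small:
  fixes L y :: real
  assumes "1/2 \<le> L" "L \<le> 7/12" "2 \<le> y"
  shows "L / 2 * (y - 2 + 2 * L + (1 - L)\<^sup>2 / 2) * (4 * L - 5/4 + (3/2 * L - 5/8)\<^sup>2 / 2) < (669/10000 + 5/14 * (2 * L - 1)) * ((y + 3 * L - 5/4) * (y - L))"
proof -
  obtain a b where ab: "0 \<le> a" "0 \<le> b" "b = 1 - a" "L = 1/2 + a * (1/12)"
    using that[of "12 * L - 6" "7 - 12 * L"] assms by (simp add: field_simps)
  obtain r where r: "0 \<le> r" "y = 2 + r" using that[of "y - 2"] assms by simp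
  have "11612160000 * ((669/10000 + 5/14 * (2 * L - 1)) * ((y + 3 * L - 5/4) * (y - L)) - (L / 2 * (y - 2 + 2 * L + (1 - L)\<^sup>2 / 2) * (4 * L - 5/4 + (3/2 * L - 5/8)\<^sup>2 / 2)) - 1/100) =
       (30803976 * b^5 + 805322412 * a * b^4 + 2631104190 * a^2 * b^3 + 3322034733 * a^3 * b^2 + 1816889164 * a^4 * b + 351427060 * a^5)
       + (713240640 * b^5 + 4907978784 * a * b^4 + 12423188736 * a^2 * b^3 + 14950319904 * a^3 * b^2 + 8696785536 * a^4 * b + 1974916224 * a^5) * r
       + (776853504 * b^5 + 4575467520 * a * b^4 + 10533335040 * a^2 * b^3 + 11915735040 * a^3 * b^2 + 6649067520 * a^4 * b + 1468053504 * a^5) * r^2"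
    unfolding ab(3,4) r(2) by (simp add: field_simps eval_nat_numeral)
  also have "0 \<le> \<dots>"
    using ab r by (intro add_nonneg_nonneg mult_nonneg_nonneg zero_le_power) simp_all
  finally show ?thesis by simp
qed

lemma poly_five_24_large:
  fixes L y :: real
  assumes "7/12 \<le> L" "L \<le> 2/3" "2 \<le> y"
  shows "L / 2 * (2 * L - 1) * (y - 2 + 2 * L + (1 - L)\<^sup>2 / 2) * (4 * L - 5/4 + (3/2 * L - 5/8)\<^sup>2 / 2) < (5/4 * L - 17/24) * ((y + 3 * L - 5/4) * (y - L))"
proof -
  obtain a b where ab: "0 \<le> a" "0 \<le> b" "b = 1 - a" "L = 7/12 + a * (1/12)"
    using that[of "12 * L - 7" "8 - 12 * L"] assms by (simp add: field_simps)
  obtain r where r: "0 \<le> r" "y = 2 + r" using that[of "y - 2"] assms by simp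
  have "398131200 * ((5/4 * L - 17/24) * ((y + 3 * L - 5/4) * (y - L)) - (L / 2 * (2 * L - 1) * (y - 2 + 2 * L + (1 - L)\<^sup>2 / 2) * (4 * L - 5/4 + (3/2 * L - 5/8)\<^sup>2 / 2)) - 1/200) =
       (346444 * b^6 + 107575964 * a * b^5 + 520139435 * a^2 * b^4 + 1007782230 * a^3 * b^3 + 972850960 * a^4 * b^2 + 467104864 * a^5 * b + 89126144 * a^6)
       + (10915200 * b^6 + 197596800 * a * b^5 + 819871200 * a^2 * b^4 + 1520640000 * a^3 * b^3 + 1454911200 * a^4 * b^2 + 704894400 * a^5 * b + 137433600 * a^6) * r
       + (8294400 * b^6 + 91238400 * a * b^5 + 331776000 * a^2 * b^4 + 580608000 * a^3 * b^3 + 539136000 * a^4 * b^2 + 257126400 * a^5 * b + 49766400 * a^6) * r^2"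
    unfolding ab(3,4) r(2) by (simp add: field_simps eval_nat_numeral)
  also have "0 \<le> \<dots>"
    using ab r by (intro add_nonneg_nonneg mult_nonneg_nonneg zero_le_power) simp_all
  finally show ?thesis by simp
qed

lemma poly_deep_lo:
  fixes L q :: real
  assumes "2/3 \<le> L" "L \<le> 5/6" "0 \<le> q" "q \<le> 1/2"
  shows "(L / 2 - (5/4 * L - 5/6)) * (1 + 2 * (L/2 - 1/6) * q + 4 * ((L/2 - 1/6) * q)\<^sup>2) + L / 2 * (2 * L - 1) * (1 - (7 - 3 * L) / 6 * q)
    < (3/4 * L - 1/3) * (1 + 2 * (1 - L) * q) + L / 2 * (1 - 2 * (3/2 * L - 5/6) * q + 19/10 * ((3/2 * L - 5/6) * q)\<^sup>2)"
proof -
  obtain a b where ab: "0 \<le> a" "0 \<le> b" "b = 1 - a" "L = 2/3 + a * (1/6)"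
    using that[of "6 * L - 4" "5 - 6 * L"] assms by (simp add: field_simps)
  obtain c d where cd: "0 \<le> c" "0 \<le> d" "d = 1 - c" "q = c / 2"
    using that[of "2 * q" "1 - 2 * q"] assms by simp
  have "345600 * ((3/4 * L - 1/3) * (1 + 2 * (1 - L) * q) + L / 2 * (1 - 2 * (3/2 * L - 5/6) * q + 19/10 * ((3/2 * L - 5/6) * q)\<^sup>2)
       - ((L / 2 - (5/4 * L - 5/6)) * (1 + 2 * (L/2 - 1/6) * q + 4 * ((L/2 - 1/6) * q)\<^sup>2) + L / 2 * (2 * L - 1) * (1 - (7 - 3 * L) / 6 * q)) - 1/200) =
       (17472 * b^3 + 119616 * a * b^2 + 177216 * a^2 * b + 75072 * a^3) * d^2
       + (31744 * b^3 + 216832 * a * b^2 + 310432 * a^2 * b + 124944 * a^3) * c * d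
       + (12592 * b^3 + 95116 * a * b^2 + 139016 * a^2 * b + 57247 * a^3) * c^2"
    unfolding ab(3,4) cd(3,4) by (simp add: field_simps eval_nat_numeral)
  also have "0 \<le> \<dots>"
    using ab cd by (intro add_nonneg_nonneg mult_nonneg_nonneg zero_le_power) simp_all
  finally show ?thesis by simp
qed

lemma poly_deep_hi:
  fixes L q :: real
  assumes "5/6 \<le> L" "L \<le> 1" "0 \<le> q" "q \<le> 1/2"
  shows "(L / 2 - (3/4 * L - 5/12)) * (1 + 2 * (L/2 - 1/6) * q + 4 * ((L/2 - 1/6) * q)\<^sup>2) + L / 2 * (2 * L - 1) * (1 - (7 - 3 * L) / 6 * q)
    < (3/4 * L - 1/3) * (1 + 2 * (1 - L) * q) + L / 2 * (1 - 2 * (3/2 * L - 5/6) * q + 19/10 * ((3/2 * L - 5/6) * q)\<^sup>2)"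
proof -
  obtain a b where ab: "0 \<le> a" "0 \<le> b" "b = 1 - a" "L = 5/6 + a * (1/6)"
    using that[of "6 * L - 5" "6 - 6 * L"] assms by (simp add: field_simps)
  obtain c d where cd: "0 \<le> c" "0 \<le> d" "d = 1 - c" "q = c / 2"
    using that[of "2 * q" "1 - 2 * q"] assms by simp
  have "345600 * ((3/4 * L - 1/3) * (1 + 2 * (1 - L) * q) + L / 2 * (1 - 2 * (3/2 * L - 5/6) * q + 19/10 * ((3/2 * L - 5/6) * q)\<^sup>2)
       - ((L / 2 - (3/4 * L - 5/12)) * (1 + 2 * (L/2 - 1/6) * q + 4 * ((L/2 - 1/6) * q)\<^sup>2) + L / 2 * (2 * L - 1) * (1 - (7 - 3 * L) / 6 * q)) - 1/200) =
       (75072 * b^3 + 244416 * a * b^2 + 254016 * a^2 * b + 84672 * a^3) * d^2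
       + (124944 * b^3 + 374432 * a * b^2 + 342432 * a^2 * b + 92544 * a^3) * c * d
       + (57247 * b^3 + 166666 * a * b^2 + 146816 * a^2 * b + 37952 * a^3) * c^2"
    unfolding ab(3,4) cd(3,4) by (simp add: field_simps eval_nat_numeral)
  also have "0 \<le> \<dots>"
    using ab cd by (intro add_nonneg_nonneg mult_nonneg_nonneg zero_le_power) simp_all
  finally show ?thesis by simp
qed

lemma poly_shallow_lo:
  fixes L q :: real
  assumes "2/3 \<le> L" "L \<le> 5/6" "0 \<le> q" "q \<le> 1/2"
  shows "(L / 2 - (3/4 * L - 1/3)) * (1 + 2 * (L/2 - 1/3) * q + 4 * ((L/2 - 1/3) * q)\<^sup>2) + L / 2 * (2 * L - 1) * (1 - (7 - 3 * L) / 6 * q)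
    < (5/4 * L - 5/6) * (1 + 2 * (1 - L) * q) + L / 2 * (1 - 2 * (3/2 * L - 2/3) * q + 19/10 * ((3/2 * L - 2/3) * q)\<^sup>2)"
proof -
  obtain a b where ab: "0 \<le> a" "0 \<le> b" "b = 1 - a" "L = 2/3 + a * (1/6)"
    using that[of "6 * L - 4" "5 - 6 * L"] assms by (simp add: field_simps)
  obtain c d where cd: "0 \<le> c" "0 \<le> d" "d = 1 - c" "q = c / 2"
    using that[of "2 * q" "1 - 2 * q"] assms by simp
  have "345600 * ((5/4 * L - 5/6) * (1 + 2 * (1 - L) * q) + L / 2 * (1 - 2 * (3/2 * L - 2/3) * q + 19/10 * ((3/2 * L - 2/3) * q)\<^sup>2)
       - ((L / 2 - (3/4 * L - 1/3)) * (1 + 2 * (L/2 - 1/3) * q + 4 * ((L/2 - 1/3) * q)\<^sup>2) + L / 2 * (2 * L - 1) * (1 - (7 - 3 * L) / 6 * q)) - 1/200) =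
       (17472 * b^3 + 119616 * a * b^2 + 177216 * a^2 * b + 75072 * a^3) * d^2
       + (12544 * b^3 + 171232 * a * b^2 + 269632 * a^2 * b + 110544 * a^3) * c * d
       + (1152 * b^3 + 80496 * a * b^2 + 137236 * a^2 * b + 58447 * a^3) * c^2"
    unfolding ab(3,4) cd(3,4) by (simp add: field_simps eval_nat_numeral)
  also have "0 \<le> \<dots>"
    using ab cd by (intro add_nonneg_nonneg mult_nonneg_nonneg zero_le_power) simp_all
  finally show ?thesis by simp
qed

lemma poly_shallow_hi:
  fixes L q :: real
  assumes "5/6 \<le> L" "L \<le> 1" "0 \<le> q" "q \<le> 1/2"
  shows "(L / 2 - (3/4 * L - 1/3)) * (1 + 2 * (L/2 - 1/3) * q + 4 * ((L/2 - 1/3) * q)\<^sup>2) + L / 2 * (2 * L - 1) * (1 - (7 - 3 * L) / 6 * q)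
    < (3/4 * L - 5/12) * (1 + 2 * (1 - L) * q) + L / 2 * (1 - 2 * (3/2 * L - 2/3) * q + 19/10 * ((3/2 * L - 2/3) * q)\<^sup>2)"
proof -
  obtain a b where ab: "0 \<le> a" "0 \<le> b" "b = 1 - a" "L = 5/6 + a * (1/6)"
    using that[of "6 * L - 5" "6 - 6 * L"] assms by (simp add: field_simps)
  obtain c d where cd: "0 \<le> c" "0 \<le> d" "d = 1 - c" "q = c / 2"
    using that[of "2 * q" "1 - 2 * q"] assms by simp
  have "345600 * ((3/4 * L - 5/12) * (1 + 2 * (1 - L) * q) + L / 2 * (1 - 2 * (3/2 * L - 2/3) * q + 19/10 * ((3/2 * L - 2/3) * q)\<^sup>2)
       - ((L / 2 - (3/4 * L - 1/3)) * (1 + 2 * (L/2 - 1/3) * q + 4 * ((L/2 - 1/3) * q)\<^sup>2) + L / 2 * (2 * L - 1) * (1 - (7 - 3 * L) / 6 * q)) - 1/200) =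
       (75072 * b^3 + 244416 * a * b^2 + 254016 * a^2 * b + 84672 * a^3) * d^2
       + (110544 * b^3 + 331232 * a * b^2 + 299232 * a^2 * b + 78144 * a^3) * c * d
       + (58447 * b^3 + 179846 * a * b^2 + 170516 * a^2 * b + 49672 * a^3) * c^2"
    unfolding ab(3,4) cd(3,4) by (simp add: field_simps eval_nat_numeral)
  also have "0 \<le> \<dots>"
    using ab cd by (intro add_nonneg_nonneg mult_nonneg_nonneg zero_le_power) simp_all
  finally show ?thesis by simp
qed

section \<open>Early switches pay for later gains\<close>

text \<open>
  Each lemma of this section compares the values of early switches with the bound on the sum of all
  later gains.  A name records the distance of the decisive phase from the crossing point.
\<close>
lemma sixth_pays:
  fixes L x :: real
  assumes "1/2 < L" "L \<le> 2/3" "1 \<le> x"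
  shows "(2 * L - 1) * (L / 2) / ((x + 1) * (x + 1 - L)) < (2 * L - 1) * (21 / 25 * L - 17 / 100) / (x + L)\<^sup>2"
proof -
  have "0 < (x + 1) * (x + 1 - L)" "0 < (x + L)\<^sup>2" using assms by simp_all
  then have "L / 2 / ((x + 1) * (x + 1 - L)) < (21 / 25 * L - 17 / 100) / (x + L)\<^sup>2"
    using poly_sixth[of L x] assms by (simp add: divide_less_eq less_divide_eq mult.commute)
  from mult_strict_left_mono[OF this, of "2 * L - 1"] show ?thesis using assms by simp
qed

text \<open>
  The margin is smallest for \<open>L\<close> near \<open>1/2\<close> and \<open>y = 2\<close>, so little may be given away there.  The two weights
  with numerator \<open>(2 L - 1) (L / 2)\<close> are subtracted, with numerator \<open>N\<close> of the difference; then powers of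
  \<open>y\<close> are cancelled after the estimates by \<open>y W\<close> and \<open>y V\<close>, which are exact at \<open>y = 2\<close>.
\<close>
lemma five_24_pays:
  fixes L y :: real
  assumes "1/2 < L" "L \<le> 2/3" "2 \<le> y"
  shows "(2 * L - 1) * (L / 2) / (y * (y - L))
    < loss L (17 / 24 - L / 2) / (y - 1 + L)\<^sup>2 + (2 * L - 1) * (L / 2) / (y + 3 / 2 * L - 5 / 8)\<^sup>2"
proof -
  define s where "s = 2 * L - 1"
  define l where "l = loss L (17 / 24 - L / 2)"
  define \<gamma> where "\<gamma> = 3 / 2 * L - 5 / 8"
  define W where "W = y - 2 + 2 * L + (1 - L)\<^sup>2 / 2"
  define V where "V = 4 * L - 5 / 4 + \<gamma>\<^sup>2 / 2"
  define N where "N = (4 * L - 5 / 4) * y + \<gamma>\<^sup>2"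
  have s: "0 < s" and \<gamma>: "0 < \<gamma>" using assms by (simp_all add: s_def \<gamma>_def)
  have WV: "0 \<le> W" "0 \<le> V" "0 \<le> N" using assms by (simp_all add: W_def V_def N_def)
  have key: "s * (L / 2) * (W * V) < l * ((y + 3 * L - 5 / 4) * (y - L))"
  proof (cases "L \<le> 7 / 12")
    case True
    have "L / 2 * W * V < (669 / 10000 + 5 / 14 * s) * ((y + 3 * L - 5 / 4) * (y - L))"
      using poly_five_24_small[of L y] True assms by (simp add: W_def V_def \<gamma>_def s_def)
    from mult_strict_left_mono[OF this s]
    have "s * (L / 2) * (W * V) < s * (669 / 10000 + 5 / 14 * s) * ((y + 3 * L - 5 / 4) * (y - L))"
      by (simp add: mult.assoc)
    also have "\<dots> \<le> l * ((y + 3 * L - 5 / 4) * (y - L))"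
      using loss_ge_five_24[of L] True assms by (intro mult_right_mono) (auto simp: l_def s_def)
    finally show ?thesis .
  next
    case False
    have "s * (L / 2) * (W * V) < (5 / 4 * L - 17 / 24) * ((y + 3 * L - 5 / 4) * (y - L))"
      using poly_five_24_large[of L y] False assms by (simp add: W_def V_def \<gamma>_def s_def ac_simps)
    also have "5 / 4 * L - 17 / 24 \<le> l"
      using tail_mass_ge_tangent[of L "17 / 24 - L / 2"] tail_mass_beyond[of L "17 / 24 - L / 2 + (2 * L - 1)"] False assms
      by (simp add: l_def loss_def)
    then have "(5 / 4 * L - 17 / 24) * ((y + 3 * L - 5 / 4) * (y - L)) \<le> l * ((y + 3 * L - 5 / 4) * (y - L))"
      using assms by (intro mult_right_mono) auto
    finally show ?thesis .
  qed
  have l: "0 \<le> l"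
    using tail_mass_antimono[of "17 / 24 - L / 2" "17 / 24 - L / 2 + (2 * L - 1)" L] assms by (simp add: l_def loss_def)
  have "y * W - (y - 1 + L)\<^sup>2 = (1 - L)\<^sup>2 * (y - 2) / 2"
    by (simp add: W_def field_simps power2_eq_square)
  then have A: "(y - 1 + L)\<^sup>2 \<le> y * W" using assms by (smt (verit) divide_nonneg_nonneg mult_nonneg_nonneg zero_le_power2)
  have "y * V - N = \<gamma>\<^sup>2 * (y - 2) / 2" by (simp add: V_def N_def field_simps)
  then have B: "N \<le> y * V" using assms by (smt (verit) divide_nonneg_nonneg mult_nonneg_nonneg zero_le_power2)
  have C: "y * (y + 3 * L - 5 / 4) \<le> (y + \<gamma>)\<^sup>2"
    using zero_le_power2[of \<gamma>] by (simp add: \<gamma>_def power2_eq_square algebra_simps)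
  have "s * (L / 2) * (N * (y - 1 + L)\<^sup>2) \<le> s * (L / 2) * ((y * V) * (y * W))"
    using A B WV s assms by (intro mult_left_mono mult_mono) auto
  also have "\<dots> = y\<^sup>2 * (s * (L / 2) * (W * V))" by (simp add: power2_eq_square)
  also have "\<dots> < y\<^sup>2 * (l * ((y + 3 * L - 5 / 4) * (y - L)))"
    using key assms by (intro mult_strict_left_mono) auto
  also have "\<dots> = l * (y * (y - L) * (y * (y + 3 * L - 5 / 4)))" by (simp add: power2_eq_square)
  also have "\<dots> \<le> l * (y * (y - L) * (y + \<gamma>)\<^sup>2)"
    using C l assms by (intro mult_left_mono) auto
  finally have "s * (L / 2) * N / (y * (y - L) * (y + \<gamma>)\<^sup>2) < l / (y - 1 + L)\<^sup>2"
    using assms \<gamma> by (simp add: divide_less_eq less_divide_eq ac_simps)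
  moreover have "s * (L / 2) / (y * (y - L)) - s * (L / 2) / (y + \<gamma>)\<^sup>2 = s * (L / 2) * N / (y * (y - L) * (y + \<gamma>)\<^sup>2)"
  proof -
    have frac: "a / b - a / c = a * (c - b) / (b * c)" if "b \<noteq> 0" "c \<noteq> 0" for a b c :: real
      using that by (simp add: field_simps)
    have "(y + \<gamma>)\<^sup>2 - y * (y - L) = N" by (simp add: N_def \<gamma>_def power2_eq_square algebra_simps)
    then show ?thesis using frac[of "y * (y - L)" "(y + \<gamma>)\<^sup>2" "s * (L / 2)"] assms \<gamma> by simp
  qed
  moreover have \<gamma>': "y + 3 / 2 * L - 5 / 8 = y + \<gamma>" by (simp add: \<gamma>_def)
  ultimately show ?thesis unfolding s_def[symmetric] l_def[symmetric] \<gamma>' by linarith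
qed

text \<open>
  Turns the lower bound for a level, with \<open>C - D = 2 L - 1\<close> and loss \<open>k (C - D)\<close>, into a product with the
  factor \<open>C - D\<close>, so that inequalities can be divided by it.
\<close>
lemma shallow_level_value_ge:
  fixes C D L k :: real
  assumes "0 < D" "D \<le> C" "0 \<le> L"
  shows "(C - D) * (k * C - L) / (C * D\<^sup>2) \<le> L / 2 / C\<^sup>2 - (L / 2 - k * (C - D)) / D\<^sup>2"
proof -
  have "L / 2 / C\<^sup>2 - (L / 2 - k * (C - D)) / D\<^sup>2 - (C - D) * (k * C - L) / (C * D\<^sup>2) = L / 2 * (C - D)\<^sup>2 / (C\<^sup>2 * D\<^sup>2)"
    using assms by (simp add: field_simps power2_eq_square)
  also have "\<dots> \<ge> 0" using assms by simp
  finally show ?thesis by simp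
qed

lemma eighth_pays:
  fixes L x :: real
  assumes "1/2 < L" "L \<le> 2/3" "2 \<le> x"
  shows "(2 * L - 1) * (L / 2) / ((x + 1) * (x + 1 - L))
    < L / 2 / (x + 3 / 2 * L - 5 / 8)\<^sup>2 - (L / 2 - (2 * L - 1) / 2) / (x + 3 / 8 - L / 2)\<^sup>2"
proof -
  let ?C = "x + 3 / 2 * L - 5 / 8" and ?D = "x + 3 / 8 - L / 2"
  have CD: "?C - ?D = 2 * L - 1" by (simp add: field_simps)
  have "0 < (x + 1) * (x + 1 - L)" "0 < ?C * ?D\<^sup>2" using assms by simp_all
  then have "L / ((x + 1) * (x + 1 - L)) < (x - L/2 - 5/8) / (?C * ?D\<^sup>2)"
    using poly_eighth[of L x] assms by (simp add: divide_less_eq less_divide_eq ac_simps)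
  from mult_strict_left_mono[OF this, of "(2 * L - 1) / 2"]
  have "(2 * L - 1) * (L / 2) / ((x + 1) * (x + 1 - L)) < (2 * L - 1) * ((x - L/2 - 5/8) / 2) / (?C * ?D\<^sup>2)"
    using assms by (simp add: ac_simps)
  also have "(x - L/2 - 5/8) / 2 = 1 / 2 * ?C - L" by (simp add: field_simps)
  also have "(2 * L - 1) * (1 / 2 * ?C - L) / (?C * ?D\<^sup>2) \<le> L / 2 / ?C\<^sup>2 - (L / 2 - (2 * L - 1) / 2) / ?D\<^sup>2"
    using shallow_level_value_ge[of ?D ?C L "1 / 2"] assms unfolding CD by simp
  finally show ?thesis .
qed

lemma twelfth_pays:
  fixes L :: real
  assumes "1/2 < L" "L \<le> 5/9"
  shows "(2 * L - 1) * (L / 2) / (2 * (2 - L))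
    < L / 2 / (5 / 12 + 3 / 2 * L)\<^sup>2 - (L / 2 - 13 / 20 * (2 * L - 1)) / (17 / 12 - L / 2)\<^sup>2"
proof -
  let ?C = "5 / 12 + 3 / 2 * L" and ?D = "17 / 12 - L / 2"
  have CD: "?C - ?D = 2 * L - 1" by (simp add: field_simps)
  have "0 < 4 * (2 - L)" "0 < ?C * ?D\<^sup>2" using assms by simp_all
  then have "L / (4 * (2 - L)) < (13 / 20 * ?C - L) / (?C * ?D\<^sup>2)"
    using poly_twelfth[of L] assms by (simp add: divide_less_eq less_divide_eq ac_simps)
  from mult_strict_left_mono[OF this, of "2 * L - 1"]
  have "(2 * L - 1) * (L / 2) / (2 * (2 - L)) < (2 * L - 1) * (13 / 20 * ?C - L) / (?C * ?D\<^sup>2)"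
    using assms by (simp add: field_simps)
  also have "\<dots> \<le> L / 2 / ?C\<^sup>2 - (L / 2 - 13 / 20 * (2 * L - 1)) / ?D\<^sup>2"
    using shallow_level_value_ge[of ?D ?C L "13 / 20"] assms unfolding CD by simp
  finally show ?thesis .
qed

text \<open>
  In terms of \<open>q = 1 / x\<close> every weight is \<open>q\<^sup>2\<close> times a function of \<open>q \<le> 1/2\<close>.  Replacing these functions by
  polynomials of degree at most two leaves an inequality between polynomials in \<open>L\<close> and \<open>q\<close>.
\<close>
lemma large_L_pays:
  fixes L x lA lD g d :: real
  assumes L: "2/3 \<le> L" "L \<le> 1" and x: "2 \<le> x"
    and lA: "0 \<le> lA" and lD: "lD \<le> L / 2" and g: "0 \<le> g" "g \<le> 5/6" and d: "0 \<le> d" "d \<le> 1/3"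
    and poly: "\<And>q. 0 \<le> q \<Longrightarrow> q \<le> 1/2 \<Longrightarrow>
      (L / 2 - lD) * (1 + 2 * d * q + 4 * (d * q)\<^sup>2) + L / 2 * (2 * L - 1) * (1 - (7 - 3 * L) / 6 * q)
      < lA * (1 + 2 * (1 - L) * q) + L / 2 * (1 - 2 * g * q + 19/10 * (g * q)\<^sup>2)"
  shows "(2 * L - 1) * (L / 2) / ((x + 1) * (x + 1 - L))
    < lA / (x - 1 + L)\<^sup>2 + (L / 2 / (x + g)\<^sup>2 - (L / 2 - lD) / (x - d)\<^sup>2)"
proof -
  define q where "q = 1 / x"
  have q: "0 < q" "q \<le> 1/2" "x * q = 1" using x by (simp_all add: q_def field_simps)
  have scale: "1 / (x + e)\<^sup>2 = q\<^sup>2 * (1 / (1 + e * q)\<^sup>2)" for e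
  proof -
    have "x + e = x * (1 + e * q)" using x by (simp add: q_def field_simps)
    then show ?thesis by (simp add: q_def power_mult_distrib power_divide)
  qed
  \<comment> \<open>Each square is replaced by a polynomial in \<open>q\<close> that bounds it on the range of \<open>q\<close>.\<close>
  have "1 + 2 * (1 - L) * q \<le> 1 / (1 + (L - 1) * q)\<^sup>2"
  proof -
    define t where "t = (1 - L) * q"
    have t: "0 \<le> t" "t \<le> 1 / 3 * (1 / 2)" unfolding t_def using L q by (intro mult_nonneg_nonneg mult_mono; simp)+
    have "(1 + 2 * t) * (1 - t)\<^sup>2 = 1 - t\<^sup>2 * (3 - 2 * t)" by (simp add: power2_eq_square algebra_simps)
    also have "\<dots> \<le> 1" using t by simp
    finally have "1 + 2 * t \<le> 1 / (1 - t)\<^sup>2" using t by (simp add: le_divide_eq)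
    then show ?thesis by (simp add: t_def algebra_simps)
  qed
  then have 1: "q\<^sup>2 * (lA * (1 + 2 * (1 - L) * q)) \<le> lA / (x - 1 + L)\<^sup>2"
  proof -
    assume *: "1 + 2 * (1 - L) * q \<le> 1 / (1 + (L - 1) * q)\<^sup>2"
    have "x - 1 + L = x + (L - 1)" by simp
    then have "lA / (x - 1 + L)\<^sup>2 = lA * (1 / (x + (L - 1))\<^sup>2)"
      by (simp only: times_divide_eq_right mult_1_right)
    also have "\<dots> = q\<^sup>2 * (lA * (1 / (1 + (L - 1) * q)\<^sup>2))" unfolding scale by simp
    finally show ?thesis using mult_left_mono[OF mult_left_mono[OF * lA], of "q\<^sup>2"] by simp
  qed
  have "1 - 2 * g * q + 19/10 * (g * q)\<^sup>2 \<le> 1 / (1 + g * q)\<^sup>2"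
  proof -
    define t where "t = g * q"
    have t: "0 \<le> t" "t \<le> 5 / 6 * (1 / 2)" unfolding t_def using g q by (intro mult_nonneg_nonneg mult_mono; simp)+
    have "(1 - 2 * t + 19/10 * t\<^sup>2) * (1 + t)\<^sup>2 = 1 - t\<^sup>2 * (11/10 - 9/5 * t - 19/10 * (t * t))"
      by (simp add: field_simps power2_eq_square)
    also have "0 \<le> 11/10 - 9/5 * t - 19/10 * (t * t)" using t mult_mono[of t "5/12" t "5/12"] by simp
    then have "1 - t\<^sup>2 * (11/10 - 9/5 * t - 19/10 * (t * t)) \<le> 1" by simp
    finally have "1 - 2 * t + 19/10 * t\<^sup>2 \<le> 1 / (1 + t)\<^sup>2" using t by (simp add: le_divide_eq)
    then show ?thesis by (simp add: t_def algebra_simps)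
  qed
  then have 2: "q\<^sup>2 * (L / 2 * (1 - 2 * g * q + 19/10 * (g * q)\<^sup>2)) \<le> L / 2 / (x + g)\<^sup>2"
  proof -
    assume *: "1 - 2 * g * q + 19/10 * (g * q)\<^sup>2 \<le> 1 / (1 + g * q)\<^sup>2"
    have "L / 2 / (x + g)\<^sup>2 = L / 2 * (1 / (x + g)\<^sup>2)" by simp
    also have "\<dots> = q\<^sup>2 * (L / 2 * (1 / (1 + g * q)\<^sup>2))" unfolding scale by simp
    finally show ?thesis using mult_left_mono[OF mult_left_mono[OF *, of "L / 2"], of "q\<^sup>2"] L by simp
  qed
  have "1 / (1 + (- d) * q)\<^sup>2 \<le> 1 + 2 * d * q + 4 * (d * q)\<^sup>2"
  proof -
    define t where "t = d * q"
    have t: "0 \<le> t" "t \<le> 1 / 3 * (1 / 2)" unfolding t_def using d q by (intro mult_nonneg_nonneg mult_mono; simp)+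
    have "(1 + 2 * t + 4 * t\<^sup>2) * (1 - t)\<^sup>2 = 1 + t\<^sup>2 * (1 - 6 * t + 4 * t\<^sup>2)"
      by (simp add: power2_eq_square algebra_simps)
    moreover have "0 \<le> t\<^sup>2 * (1 - 6 * t + 4 * t\<^sup>2)" using t by (intro mult_nonneg_nonneg add_nonneg_nonneg) auto
    ultimately have "1 / (1 - t)\<^sup>2 \<le> 1 + 2 * t + 4 * t\<^sup>2" using t by (simp add: divide_le_eq)
    then show ?thesis by (simp add: t_def algebra_simps)
  qed
  then have 3: "(L / 2 - lD) / (x - d)\<^sup>2 \<le> q\<^sup>2 * ((L / 2 - lD) * (1 + 2 * d * q + 4 * (d * q)\<^sup>2))"
  proof -
    assume *: "1 / (1 + (- d) * q)\<^sup>2 \<le> 1 + 2 * d * q + 4 * (d * q)\<^sup>2"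
    have "(L / 2 - lD) / (x - d)\<^sup>2 = (L / 2 - lD) * (1 / (x + (- d))\<^sup>2)" by simp
    also have "\<dots> = q\<^sup>2 * ((L / 2 - lD) * (1 / (1 + (- d) * q)\<^sup>2))" unfolding scale by simp
    finally show ?thesis using mult_left_mono[OF mult_left_mono[OF *, of "L / 2 - lD"], of "q\<^sup>2"] lD by simp
  qed
  \<comment> \<open>A convex function of \<open>q\<close> lies below its chord over \<open>[0, 1/2]\<close>; the slope is rounded up to be affine in \<open>L\<close>.\<close>
  have "1 / ((1 + q) * (1 + (1 - L) * q)) \<le> 1 - (7 - 3 * L) / 6 * q"
  proof -
    define \<theta> where "\<theta> = 1 - L"
    have \<theta>: "0 \<le> \<theta>" "\<theta> \<le> 1 / 3" using L by (simp_all add: \<theta>_def)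
    have "(1 - (4 + 3 * \<theta>) / 6 * q) * ((1 + q) * (1 + \<theta> * q))
        = 1 + q * ((1 - 2 * q) * (2 + 3 * \<theta>) / 6 + q * (\<theta> * (2 - 3 * \<theta>)) / 4
            + (4 + 3 * \<theta>) / 6 * \<theta> * q * (1 / 2 - q))"
      by (simp add: field_simps)
    also have "\<dots> \<ge> 1"
      using \<theta> q by (simp add: add_nonneg_nonneg mult_nonneg_nonneg)
    finally have "1 / ((1 + q) * (1 + \<theta> * q)) \<le> 1 - (4 + 3 * \<theta>) / 6 * q"
      using \<theta> q by (simp add: divide_le_eq add_pos_nonneg)
    then show ?thesis by (simp add: \<theta>_def)
  qed
  then have 4: "(2 * L - 1) * (L / 2) / ((x + 1) * (x + 1 - L)) \<le> q\<^sup>2 * (L / 2 * (2 * L - 1) * (1 - (7 - 3 * L) / 6 * q))"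
  proof -
    assume *: "1 / ((1 + q) * (1 + (1 - L) * q)) \<le> 1 - (7 - 3 * L) / 6 * q"
    have "x + 1 = x * (1 + q)" "x + 1 - L = x * (1 + (1 - L) * q)"
      using x by (simp_all add: q_def field_simps)
    then have "1 / ((x + 1) * (x + 1 - L)) = q\<^sup>2 * (1 / ((1 + q) * (1 + (1 - L) * q)))"
      by (simp add: q_def power2_eq_square)
    then have "(2 * L - 1) * (L / 2) / ((x + 1) * (x + 1 - L)) = q\<^sup>2 * (L / 2 * (2 * L - 1) * (1 / ((1 + q) * (1 + (1 - L) * q))))"
      unfolding divide_inverse[of "(2 * L - 1) * (L / 2)"] inverse_eq_divide by (simp add: ac_simps)
    then show ?thesis
      using mult_left_mono[OF mult_left_mono[OF *, of "L / 2 * (2 * L - 1)"], of "q\<^sup>2"] L by simp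
  qed
  have "q\<^sup>2 * ((L / 2 - lD) * (1 + 2 * d * q + 4 * (d * q)\<^sup>2) + L / 2 * (2 * L - 1) * (1 - (7 - 3 * L) / 6 * q))
      < q\<^sup>2 * (lA * (1 + 2 * (1 - L) * q) + L / 2 * (1 - 2 * g * q + 19/10 * (g * q)\<^sup>2))"
    using q poly[of q] by (intro mult_strict_left_mono) auto
  then show ?thesis using 1 2 3 4 unfolding distrib_left[of "q\<^sup>2"] by linarith
qed

text \<open>
  The switch \<open>v\<close> is the first one below the crossing point \<open>(1 - L) / 2\<close>, and \<open>u\<close> is its predecessor.
  If \<open>v\<close> is within \<open>1/8\<close> of the crossing point, its own loss pays for all later gains.  If it is within
  \<open>1/6\<close>, then \<open>u\<close> is within \<open>5/24\<close> on the other side, and the two losses together pay.  If \<open>v\<close> is lower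
  still, then \<open>u\<close> is within \<open>1/6\<close> and pays alone.  In the last two cases \<open>v\<close> is charged with its full
  gain, which is why that gain appears in the second alternative.
\<close>
lemma small_L_pair_pays:
  assumes L: "1/2 < L" "L \<le> 2/3" and \<nu>: "2 \<le> \<nu>"
    and uv: "1 - L \<le> 2 * u" "2 * v < 1 - L" "u \<le> v + 1/3"
  shows "(2 * L - 1) * (L / 2) / ((\<nu> + 1) * (\<nu> + 1 - L)) < level L (\<nu> - 1) (min u L) + level L \<nu> v
    \<or> (2 * L - 1) * (L / 2) / (\<nu> * (\<nu> - L)) < level L (\<nu> - 1) (min u L) + level L \<nu> v + gain L \<nu>"
proof -
  let ?s = "2 * L - 1"
  have v: "- (1/3) \<le> v" using uv L by linarith
  have u0: "0 \<le> level L (\<nu> - 1) (min u L)"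
    using L \<nu> uv by (intro level_nonneg) auto
  consider "3/8 - L/2 \<le> v" | "1/3 - L/2 \<le> v" "v < 3/8 - L/2" | "v < 1/3 - L/2" by linarith
  then show ?thesis
  proof cases
    case 1
    have "L / 2 / (\<nu> + (3/8 - L/2) + ?s)\<^sup>2 - (L / 2 - ?s / 2) / (\<nu> + (3/8 - L/2))\<^sup>2 \<le> level L \<nu> (3/8 - L/2)"
      using L \<nu> loss_ge_half[of L] by (intro level_ge_half_minus) auto
    also have "\<dots> \<le> level L \<nu> v" using 1 L \<nu> uv v by (intro level_mono) auto
    finally have *: "L / 2 / (\<nu> + (3/8 - L/2) + ?s)\<^sup>2 - (L / 2 - ?s / 2) / (\<nu> + (3/8 - L/2))\<^sup>2 \<le> level L \<nu> v" .
    have e1: "\<nu> + (3/8 - L/2) + ?s = \<nu> + 3/2 * L - 5/8" and e2: "\<nu> + (3/8 - L/2) = \<nu> + 3/8 - L/2" by simp_all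
    show ?thesis using *[unfolded e1, unfolded e2] eighth_pays[OF L \<nu>] u0 by linarith
  next
    case 2
    have u: "u \<le> 17/24 - L/2" using 2 uv by linarith
    have "loss L (17/24 - L/2) / (\<nu> - 1 + L)\<^sup>2 \<le> level L (\<nu> - 1) (17/24 - L/2)"
      using L \<nu> by (intro level_ge_weight_loss) auto
    also have "\<dots> \<le> level L (\<nu> - 1) (min u L)"
      using L \<nu> u uv by (intro level_antimono) auto
    finally have 3: "loss L (17/24 - L/2) / (\<nu> - 1 + L)\<^sup>2 \<le> level L (\<nu> - 1) (min u L)" .
    have "?s * (L / 2) \<le> ?s * (21/25 * L - 17/100)" using L by (intro mult_left_mono) auto
    also have "\<dots> \<le> loss L (2/3 - L/2)" using L by (intro loss_ge_sixth) auto
    also have "\<dots> = loss L (1/3 - L/2)" using loss_reflect[of L "1/3 - L/2"] L by (simp add: algebra_simps)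
    also have "\<dots> \<le> loss L v" using L 2 uv by (intro loss_mono) auto
    finally have l: "?s * (L / 2) \<le> loss L v" .
    have "0 \<le> ?s * (L / 2)" using L by simp
    with l have "0 \<le> loss L v" by linarith
    have "?s * (L / 2) / (\<nu> + 3/2 * L - 5/8)\<^sup>2 \<le> loss L v / (\<nu> + v + ?s)\<^sup>2"
      using l \<open>0 \<le> loss L v\<close> L 2 \<nu> v by (intro frac_le power_mono) auto
    also have "\<dots> \<le> level L \<nu> v + gain L \<nu>"
      using level_ge_loss_minus_gain[of L v \<nu>] L 2 \<nu> uv v by simp
    finally show ?thesis using 3 five_24_pays[OF L \<nu>] by linarith
  next
    case 3
    have u: "u \<le> 2/3 - L/2" using 3 uv by linarith
    have "?s * (21/25 * L - 17/100) / (\<nu> - 1 + L)\<^sup>2 \<le> loss L (2/3 - L/2) / (\<nu> - 1 + L)\<^sup>2"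
      using L by (intro divide_right_mono loss_ge_sixth) auto
    also have "\<dots> \<le> level L (\<nu> - 1) (2/3 - L/2)"
      using L \<nu> by (intro level_ge_weight_loss) auto
    also have "\<dots> \<le> level L (\<nu> - 1) (min u L)"
      using L \<nu> u uv by (intro level_antimono) auto
    finally have "?s * (21/25 * L - 17/100) / (\<nu> - 1 + L)\<^sup>2 \<le> level L (\<nu> - 1) (min u L)" .
    moreover have "- gain L \<nu> \<le> level L \<nu> v"
      using L \<nu> v uv by (intro level_ge_minus_gain) auto
    ultimately show ?thesis using sixth_pays[of L "\<nu> - 1"] L \<nu> by simp
  qed
qed

text \<open>
  For larger \<open>L\<close> both switches contribute: either \<open>v\<close> is within \<open>1/6\<close> of the crossing point and \<open>u\<close> within
  \<open>1/3\<close> on the other side, or \<open>v\<close> is within \<open>1/3\<close> and \<open>u\<close> within \<open>1/6\<close>.  Here \<open>l6\<close> and \<open>l3\<close> bound the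
  losses at these two distances.
\<close>
lemma large_L_pair_pays:
  assumes L: "2/3 \<le> L" "L \<le> 1" and \<nu>: "2 \<le> \<nu>"
    and uv: "1 - L \<le> 2 * u" "2 * v < 1 - L" "u \<le> v + 1/3"
  shows "(2 * L - 1) * (L / 2) / ((\<nu> + 1) * (\<nu> + 1 - L)) < level L (\<nu> - 1) (min u L) + level L \<nu> v"
proof -
  let ?s = "2 * L - 1"
  define l6 where "l6 = 3/4 * L - 1/3"
  define l3 where "l3 = (if L \<le> 5/6 then 5/4 * L - 5/6 else 3/4 * L - 5/12)"
  have v: "1/6 - L/2 \<le> v" using uv L by linarith
  have l6: "l6 \<le> loss L (2/3 - L/2)"
    using tail_mass_ge_half[of L "2/3 - L/2"] tail_mass_beyond[of L "2/3 - L/2 + ?s"] L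
    by (simp add: loss_def l6_def)
  have l3: "l3 \<le> loss L (5/6 - L/2)"
    using tail_mass_ge_half[of L "5/6 - L/2"] tail_mass_ge_tangent[of L "5/6 - L/2"]
      tail_mass_beyond[of L "5/6 - L/2 + ?s"] L
    by (cases "L \<le> 5/6") (simp_all add: loss_def l3_def)
  have refl: "loss L (1/3 - L/2) = loss L (2/3 - L/2)" "loss L (1/6 - L/2) = loss L (5/6 - L/2)"
    using loss_reflect[of L "1/3 - L/2"] loss_reflect[of L "1/6 - L/2"] L by (simp_all add: algebra_simps)
  have bnd: "0 \<le> l3" "l3 \<le> L / 2" "0 \<le> l6" "l6 \<le> L / 2" using L by (auto simp: l3_def l6_def)
  show ?thesis
  proof (cases "1/3 - L/2 \<le> v")
    case True
    have "l3 / (\<nu> - 1 + L)\<^sup>2 \<le> loss L (5/6 - L/2) / (\<nu> - 1 + L)\<^sup>2"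
      using l3 by (intro divide_right_mono) auto
    also have "\<dots> \<le> level L (\<nu> - 1) (5/6 - L/2)"
      using L \<nu> by (intro level_ge_weight_loss) auto
    also have "\<dots> \<le> level L (\<nu> - 1) (min u L)"
      using L \<nu> uv by (intro level_antimono) auto
    finally have 1: "l3 / (\<nu> - 1 + L)\<^sup>2 \<le> level L (\<nu> - 1) (min u L)" .
    have "L / 2 / (\<nu> + (1/3 - L/2) + ?s)\<^sup>2 - (L / 2 - l6) / (\<nu> + (1/3 - L/2))\<^sup>2 \<le> level L \<nu> (1/3 - L/2)"
      using L \<nu> l6 refl by (intro level_ge_half_minus) auto
    also have "\<dots> \<le> level L \<nu> v" using True L \<nu> uv v by (intro level_mono) auto
    finally have 2: "L / 2 / (\<nu> + (1/3 - L/2) + ?s)\<^sup>2 - (L / 2 - l6) / (\<nu> + (1/3 - L/2))\<^sup>2 \<le> level L \<nu> v" .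
    have "?s * (L / 2) / ((\<nu> + 1) * (\<nu> + 1 - L))
      < l3 / (\<nu> - 1 + L)\<^sup>2 + (L / 2 / (\<nu> + (3/2 * L - 2/3))\<^sup>2 - (L / 2 - l6) / (\<nu> - (L/2 - 1/3))\<^sup>2)"
    proof (rule large_L_pays)
      fix q :: real assume q: "0 \<le> q" "q \<le> 1/2"
      show "(L / 2 - l6) * (1 + 2 * (L/2 - 1/3) * q + 4 * ((L/2 - 1/3) * q)\<^sup>2) + L / 2 * ?s * (1 - (7 - 3 * L) / 6 * q)
        < l3 * (1 + 2 * (1 - L) * q) + L / 2 * (1 - 2 * (3/2 * L - 2/3) * q + 19/10 * ((3/2 * L - 2/3) * q)\<^sup>2)"
        using poly_shallow_lo[of L q] poly_shallow_hi[of L q] L q unfolding l3_def l6_def by (cases "L \<le> 5/6") simp_all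
    qed (use L \<nu> bnd in auto)
    moreover have e1: "\<nu> + (1/3 - L/2) + ?s = \<nu> + (3/2 * L - 2/3)" and e2: "\<nu> + (1/3 - L/2) = \<nu> - (L/2 - 1/3)" by simp_all
    ultimately show ?thesis using 1 2[unfolded e1, unfolded e2] by linarith
  next
    case False
    have u: "u \<le> 2/3 - L/2" using False uv by linarith
    have "l6 / (\<nu> - 1 + L)\<^sup>2 \<le> loss L (2/3 - L/2) / (\<nu> - 1 + L)\<^sup>2"
      using l6 by (intro divide_right_mono) auto
    also have "\<dots> \<le> level L (\<nu> - 1) (2/3 - L/2)"
      using L \<nu> by (intro level_ge_weight_loss) auto
    also have "\<dots> \<le> level L (\<nu> - 1) (min u L)"
      using L \<nu> u uv by (intro level_antimono) auto
    finally have 1: "l6 / (\<nu> - 1 + L)\<^sup>2 \<le> level L (\<nu> - 1) (min u L)" .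
    have "L / 2 / (\<nu> + (1/6 - L/2) + ?s)\<^sup>2 - (L / 2 - l3) / (\<nu> + (1/6 - L/2))\<^sup>2 \<le> level L \<nu> (1/6 - L/2)"
      using L \<nu> l3 refl by (intro level_ge_half_minus) auto
    also have "\<dots> \<le> level L \<nu> v" using L \<nu> uv v by (intro level_mono) auto
    finally have 2: "L / 2 / (\<nu> + (1/6 - L/2) + ?s)\<^sup>2 - (L / 2 - l3) / (\<nu> + (1/6 - L/2))\<^sup>2 \<le> level L \<nu> v" .
    have "?s * (L / 2) / ((\<nu> + 1) * (\<nu> + 1 - L))
      < l6 / (\<nu> - 1 + L)\<^sup>2 + (L / 2 / (\<nu> + (3/2 * L - 5/6))\<^sup>2 - (L / 2 - l3) / (\<nu> - (L/2 - 1/6))\<^sup>2)"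
    proof (rule large_L_pays)
      fix q :: real assume q: "0 \<le> q" "q \<le> 1/2"
      show "(L / 2 - l3) * (1 + 2 * (L/2 - 1/6) * q + 4 * ((L/2 - 1/6) * q)\<^sup>2) + L / 2 * ?s * (1 - (7 - 3 * L) / 6 * q)
        < l6 * (1 + 2 * (1 - L) * q) + L / 2 * (1 - 2 * (3/2 * L - 5/6) * q + 19/10 * ((3/2 * L - 5/6) * q)\<^sup>2)"
        using poly_deep_lo[of L q] poly_deep_hi[of L q] L q unfolding l3_def l6_def by (cases "L \<le> 5/6") simp_all
    qed (use L \<nu> bnd in auto)
    moreover have e1: "\<nu> + (1/6 - L/2) + ?s = \<nu> + (3/2 * L - 5/6)" and e2: "\<nu> + (1/6 - L/2) = \<nu> - (L/2 - 1/6)" by simp_all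
    ultimately show ?thesis using 1 2[unfolded e1, unfolded e2] by linarith
  qed
qed

lemma pair_pays:
  assumes L: "1/2 < L" "L \<le> 1" and \<nu>: "2 \<le> \<nu>"
    and uv: "1 - L \<le> 2 * u" "2 * v < 1 - L" "u \<le> v + 1/3"
  shows "\<exists>\<delta>>0. \<forall>n. \<delta> + (\<Sum>j<n. gain L (\<nu> + 1 + real j)) \<le> level L (\<nu> - 1) (min u L) + level L \<nu> v"
proof -
  let ?f = "level L (\<nu> - 1) (min u L) + level L \<nu> v"
  let ?S = "(2 * L - 1) * (L / 2) / ((\<nu> + 1) * (\<nu> + 1 - L))" and ?S' = "(2 * L - 1) * (L / 2) / (\<nu> * (\<nu> - L))"
  consider "?S < ?f" | "?S' < ?f + gain L \<nu>"
    using small_L_pair_pays[of L \<nu> u v] large_L_pair_pays[of L \<nu> u v] assms by fastforce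
  then show ?thesis
  proof cases
    case 1
    have "(\<Sum>j<n. gain L (\<nu> + 1 + real j)) \<le> ?S" for n
      using L \<nu> by (intro sum_gain_le) auto
    then show ?thesis using 1 by (intro exI[of _ "?f - ?S"]) (simp add: add_increasing)
  next
    case 2
    have "gain L \<nu> + (\<Sum>j<n. gain L (\<nu> + 1 + real j)) \<le> ?S'" for n
    proof -
      have "gain L \<nu> + (\<Sum>j<n. gain L (\<nu> + 1 + real j)) = (\<Sum>j<Suc n. gain L (\<nu> + real j))"
        by (simp only: sum.lessThan_Suc_shift) (simp add: add_ac)
      also have "\<dots> \<le> ?S'" using L \<nu> by (intro sum_gain_le) auto
      finally show ?thesis .
    qed
    then have "(?f + gain L \<nu> - ?S') + (\<Sum>j<n. gain L (\<nu> + 1 + real j)) \<le> ?f" for n by (smt (verit))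
    then show ?thesis using 2 by (intro exI[of _ "?f + gain L \<nu> - ?S'"]) simp
  qed
qed

text \<open>
  The second switch can be low already, without a lossy predecessor.  This happens only for
  \<open>L \<le> 5/9\<close>, and then the switch is within \<open>1/12\<close> of the crossing point and pays alone.
\<close>
lemma first_step_pays:
  assumes L: "1/2 < L" "L \<le> 5/9" and v: "5/12 - L/2 \<le> v" "2 * v < 1 - L"
  shows "\<exists>\<delta>>0. \<forall>n. \<delta> + (\<Sum>j<n. gain L (2 + real j)) \<le> level L 1 v"
proof -
  let ?S = "(2 * L - 1) * (L / 2) / (2 * (2 - L))"
  have "L / 2 / (1 + (5/12 - L/2) + (2 * L - 1))\<^sup>2 - (L / 2 - 13/20 * (2 * L - 1)) / (1 + (5/12 - L/2))\<^sup>2 \<le> level L 1 (5/12 - L/2)"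
    using L loss_ge_13_20[of L] by (intro level_ge_half_minus) auto
  also have "\<dots> \<le> level L 1 v" using L v by (intro level_mono) auto
  finally have *: "L / 2 / (1 + (5/12 - L/2) + (2 * L - 1))\<^sup>2 - (L / 2 - 13/20 * (2 * L - 1)) / (1 + (5/12 - L/2))\<^sup>2 \<le> level L 1 v" .
  have e1: "1 + (5/12 - L/2) + (2 * L - 1) = 5/12 + 3/2 * L" and e2: "1 + (5/12 - L/2) = 17/12 - L/2" by simp_all
  have "?S < level L 1 v" using *[unfolded e1, unfolded e2] twelfth_pays[OF L] by linarith
  moreover have "(\<Sum>j<n. gain L (2 + real j)) \<le> ?S" for n
    using L by (intro sum_gain_le) auto
  ultimately show ?thesis by (intro exI[of _ "level L 1 v - ?S"]) (simp add: add_increasing)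
qed

section \<open>Chains of switches\<close>

definition clip :: "real \<Rightarrow> real \<Rightarrow> real" where
  "clip L t = max (- L) (min t L)"

lemma clip_above: "0 < L \<Longrightarrow> 0 \<le> t \<Longrightarrow> clip L t = min t L"
  by (simp add: clip_def)

lemma clipped_level_nonneg:
  assumes "1/2 < L" "L \<le> 1" "1 - L \<le> 2 * t" "0 < \<nu> + t"
  shows "0 \<le> level L \<nu> (clip L t)"
  using assms by (cases "t \<le> L") (auto simp: clip_above level_at_L intro!: level_nonneg)

text \<open>
  The phases of the successive switches, seen in one fixed period.  Index \<open>m\<close> sits at the offset
  \<open>\<nu> + m\<close>; by the spacing of the switches a phase falls by at most \<open>1/3\<close> from one to the next.
  A phase is low if it lies below the crossing point, where switches can gain.  Offsets of low phases are
  at least \<open>2\<close>, except that the second switch of the first period, with offset \<open>1\<close>, may be slightly low.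
\<close>
locale chain =
  fixes L \<nu> :: real and t :: "nat \<Rightarrow> real"
  assumes L: "1/2 < L" "L \<le> 1"
    and start: "1 - L \<le> 2 * t 0"
    and step: "\<And>m. t m - 1/3 \<le> t (Suc m)"
    and pos: "\<And>m. 0 < \<nu> + real m + t m"
    and low: "\<And>m. 2 * t m < 1 - L \<Longrightarrow>
      2 \<le> \<nu> + real m \<or> \<nu> + real m = 1 \<and> L \<le> 5/9 \<and> 5/12 - L/2 \<le> t m"
begin

definition cost :: "nat \<Rightarrow> real" where
  "cost m = level L (\<nu> + real m) (clip L (t m))"

lemma cost_nonneg: "1 - L \<le> 2 * t m \<Longrightarrow> 0 \<le> cost m"
  unfolding cost_def using L pos[of m] by (intro clipped_level_nonneg) auto

lemma cost_ge_minus_gain: "L < \<nu> + real m \<Longrightarrow> - gain L (\<nu> + real m) \<le> cost m"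
  unfolding cost_def using L by (intro level_ge_minus_gain) (auto simp: clip_def)

text \<open>
  No switch before \<open>M\<close> costs less than zero, and every switch after \<open>M\<close> gains at most \<open>gain\<close>.  The switch
  \<open>M\<close> and its predecessor pay for all these gains, with a margin that does not depend on how many
  there are.
\<close>
lemma first_low_pays:
  assumes M: "2 * t M < 1 - L" "\<And>m. m < M \<Longrightarrow> 1 - L \<le> 2 * t m"
  shows "\<exists>\<delta>>0. \<forall>N>M. \<delta> \<le> (\<Sum>m<N. cost m)"
proof -
  have "M \<noteq> 0" using M(1) start by (cases M) auto
  then obtain M' where M': "M = Suc M'" by (cases M) auto
  have u: "1 - L \<le> 2 * t M'" and uv: "t M' \<le> t M + 1/3"
    using M(2)[of M'] step[of M'] by (auto simp: M')
  have cv: "clip L (t M) = t M" and cu: "clip L (t M') = min (t M') L"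
    using M(1) u uv L by (auto simp: clip_def)
  have before: "cost M' \<le> (\<Sum>m<M. cost m)"
    using cost_nonneg M(2) by (intro member_le_sum) (auto simp: M')
  have "\<exists>\<delta>>0. \<forall>n. \<delta> + (\<Sum>j<n. gain L (\<nu> + real M + 1 + real j)) \<le> cost M' + cost M"
  proof (cases "2 \<le> \<nu> + real M")
    case True
    have "\<nu> + real M - 1 = \<nu> + real M'" by (simp add: M')
    from pair_pays[OF L True u M(1) uv, unfolded this] show ?thesis by (simp only: cost_def cv cu)
  next
    case False
    then have one: "\<nu> + real M = 1" "L \<le> 5/9" "5/12 - L/2 \<le> t M" using low[OF M(1)] by auto
    from first_step_pays[OF L(1) one(2,3) M(1)]
    obtain \<delta> where "0 < \<delta>" "\<And>n. \<delta> + (\<Sum>j<n. gain L (2 + real j)) \<le> cost M"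
      by (auto simp: cost_def cv one)
    then show ?thesis using cost_nonneg[OF u] one(1) by (intro exI[of _ \<delta>]) (auto simp: add_increasing)
  qed
  then obtain \<delta> where \<delta>: "0 < \<delta>" "\<And>n. \<delta> + (\<Sum>j<n. gain L (\<nu> + real M + 1 + real j)) \<le> cost M' + cost M"
    by blast
  have "(\<Sum>m<Suc M. cost m) - (\<Sum>j<n. gain L (\<nu> + real M + 1 + real j)) \<le> (\<Sum>m<Suc M + n. cost m)" for n
  proof (induction n)
    case (Suc n)
    have "L < \<nu> + real (Suc M + n)" using low[OF M(1)] L by auto
    from cost_ge_minus_gain[OF this] show ?case using Suc by (simp add: algebra_simps)
  qed simp
  note after = this
  have "\<delta> \<le> (\<Sum>m<N. cost m)" if "M < N" for N
  proof -
    have "N = Suc M + (N - Suc M)" using that by simp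
    then show ?thesis using after[of "N - Suc M"] \<delta>(2)[of "N - Suc M"] before by simp
  qed
  then show ?thesis using \<delta>(1) by blast
qed

lemma sum_nonneg: "0 \<le> (\<Sum>m<N. cost m)"
proof (cases "\<exists>m<N. 2 * t m < 1 - L")
  case True
  then obtain m where m: "m < N" "2 * t m < 1 - L" by blast
  then obtain M where M: "2 * t M < 1 - L" "\<And>m. m < M \<Longrightarrow> 1 - L \<le> 2 * t m"
    using exists_least_iff[of "\<lambda>m. 2 * t m < 1 - L"] by (auto simp: not_less)
  have "M \<le> m" using M(2)[of m] m(2) by (meson not_less)
  then have "M < N" using m(1) by simp
  moreover obtain \<delta> where "0 < \<delta>" "\<forall>N>M. \<delta> \<le> (\<Sum>m<N. cost m)" using first_low_pays[OF M] by blast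
  ultimately show ?thesis by fastforce
next
  case False
  then have "1 - L \<le> 2 * t m" if "m < N" for m using that by (meson not_less)
  then show ?thesis by (intro Groups_Big.sum_nonneg cost_nonneg) auto
qed

lemma sum_pos:
  assumes "t m0 < L"
  shows "\<exists>\<delta>>0. \<exists>N0. \<forall>N\<ge>N0. \<delta> \<le> (\<Sum>m<N. cost m)"
proof (cases "\<exists>m. 2 * t m < 1 - L")
  case True
  then obtain M where M: "2 * t M < 1 - L" "\<And>m. m < M \<Longrightarrow> 1 - L \<le> 2 * t m"
    using exists_least_iff[of "\<lambda>m. 2 * t m < 1 - L"] by (auto simp: not_less)
  obtain \<delta> where "0 < \<delta>" "\<forall>N>M. \<delta> \<le> (\<Sum>m<N. cost m)" using first_low_pays[OF M] by blast
  then show ?thesis by (intro exI[of _ \<delta>] conjI exI[of _ "Suc M"]) auto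
next
  case False
  then have t: "1 - L \<le> 2 * t m" for m by (auto simp: not_less)
  have "clip L (t m0) = t m0" using assms t[of m0] L by (auto simp: clip_def)
  then have "0 < cost m0" unfolding cost_def using assms t[of m0] L pos[of m0] by (simp add: level_pos)
  moreover have "cost m0 \<le> (\<Sum>m<N. cost m)" if "Suc m0 \<le> N" for N
    using that cost_nonneg t by (intro member_le_sum) auto
  ultimately show ?thesis by blast
qed

end

section \<open>The deficit of a switch\<close>

lemma sum_levels_beyond: "0 < L \<Longrightarrow> L \<le> T \<Longrightarrow> (\<Sum>k<K. level L (\<nu> - 2 * L * real k) (clip L (T + 2 * L * real k))) = 0"
proof (intro sum.neutral ballI)
  fix k assume "0 < L" "L \<le> T"
  then have "L \<le> T + 2 * L * real k" by (simp add: add_increasing2)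
  then have "clip L (T + 2 * L * real k) = L" using \<open>0 < L\<close> by (auto simp: clip_def)
  then show "level L (\<nu> - 2 * L * real k) (clip L (T + 2 * L * real k)) = 0" by (simp add: level_at_L)
qed

lemma gap_periodic: "0 < L \<Longrightarrow> gap L (z + 2 * L) = gap L z"
  using bump_periodic[of L z 1] bump_periodic[of L "z + (2 * L - 1)" 1]
  by (simp add: gap_def algebra_simps)

text \<open>
  Cutting the integral at the points \<open>-L, -3 L, \<dots>\<close> and moving each piece by a multiple of the period \<open>2 L\<close>
  to \<open>[-L, L]\<close> replaces the offset \<open>\<nu>\<close> by \<open>\<nu> - 2 L k\<close>.  Levels not reached by \<open>T\<close> contribute zero because
  of the clipping.
\<close>
lemma integral_gap_eq_sum_levels:
  assumes "1/2 \<le> L" "L \<le> 1" "0 < \<nu> + T" "T \<le> L" "L - 2 * L * real K \<le> T"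
  shows "integral {T..L} (\<lambda>z. gap L z / (\<nu> + z)\<^sup>2)
    = (\<Sum>k<K. level L (\<nu> - 2 * L * real k) (clip L (T + 2 * L * real k)))"
  using assms(3-)
proof (induction K arbitrary: \<nu> T)
  case 0
  then show ?case by simp
next
  case (Suc K)
  let ?w = "\<lambda>\<nu> z. gap L z / (\<nu> + z)\<^sup>2"
  have split: "(\<Sum>k<Suc K. level L (\<nu> - 2 * L * real k) (clip L (T + 2 * L * real k)))
      = level L \<nu> (clip L T) + (\<Sum>k<K. level L ((\<nu> - 2 * L) - 2 * L * real k) (clip L ((T + 2 * L) + 2 * L * real k)))"
    by (simp only: sum.lessThan_Suc_shift) (simp add: algebra_simps)
  show ?case
  proof (cases "- L \<le> T")
    case True
    then have "clip L T = T" using Suc.prems by (simp add: clip_def)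
    then show ?thesis
      unfolding split using sum_levels_beyond[of L "T + 2 * L" "\<nu> - 2 * L" K] True assms by (simp add: level_def)
  next
    case False
    then have cl: "clip L T = - L" using assms by (simp add: clip_def)
    have "integral {T..-L} (?w \<nu>) + integral {-L..L} (?w \<nu>) = integral {T..L} (?w \<nu>)"
      using False Suc.prems assms
      by (intro Henstock_Kurzweil_Integration.integral_combine integrable_gap_weight) auto
    moreover have "integral {T..-L} (?w \<nu>) = integral {T + 2 * L..L} (?w (\<nu> - 2 * L))"
    proof -
      have "integral {T..-L} (?w \<nu>) = integral {T..-L} (?w (\<nu> - 2 * L) \<circ> (+) (2 * L))"
        using assms gap_periodic[of L] by (simp add: o_def add.commute)
      also have "\<dots> = integral {T + 2 * L..- L + 2 * L} (?w (\<nu> - 2 * L))"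
        by (rule integral_shift_Icc_real)
      finally show ?thesis by simp
    qed
    moreover have "integral {T + 2 * L..L} (?w (\<nu> - 2 * L))
      = (\<Sum>k<K. level L ((\<nu> - 2 * L) - 2 * L * real k) (clip L ((T + 2 * L) + 2 * L * real k)))"
      using False Suc.prems by (intro Suc.IH) (auto simp: algebra_simps)
    ultimately show ?thesis unfolding split cl by (simp add: level_def)
  qed
qed

definition piece :: "real \<Rightarrow> nat \<Rightarrow> real \<Rightarrow> real" where
  "piece L n x = bump L (x - real n) / x\<^sup>2"

text \<open>
  The lower limit \<open>1/2\<close> avoids the singularity of \<open>1 / x\<^sup>2\<close>.  Nothing is switched before \<open>1/2\<close>.
\<close>
definition mass :: "real \<Rightarrow> nat \<Rightarrow> real \<Rightarrow> real" where
  "mass L n x = integral {1/2..x} (piece L n)"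

text \<open>
  What is lost if the switch from index \<open>m\<close> to \<open>m + 1\<close> takes place at \<open>x\<close> instead of \<open>m + 1\<close>.
  Differences of antiderivatives cover both orders of \<open>x\<close> and \<open>m + 1\<close>.
\<close>
definition deficit :: "real \<Rightarrow> nat \<Rightarrow> real \<Rightarrow> real" where
  "deficit L m x = (mass L m (real m + 1) - mass L m x) - (mass L (Suc m) (real m + 1) - mass L (Suc m) x)"

lemma piece_integrable: "0 < a \<Longrightarrow> piece L n integrable_on {a..b}"
  unfolding piece_def
  by (intro integrable_continuous_real continuous_intros) auto

lemma mass_diff: "1/2 \<le> a \<Longrightarrow> a \<le> b \<Longrightarrow> mass L n b - mass L n a = integral {a..b} (piece L n)"
  unfolding mass_def
  using Henstock_Kurzweil_Integration.integral_combine[of "1/2" a b "piece L n"] piece_integrable[of "1/2" L n b] by simp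

lemma piece_diff:
  assumes "1/2 \<le> L"
  shows "piece L m (z + real m) - piece L (Suc m) (z + real m) = gap L z / (real m + z)\<^sup>2"
  using bump_periodic[of L "z - 1" 1] assms
  by (simp add: piece_def gap_def diff_divide_distrib algebra_simps)

lemma integral_piece_diff:
  assumes "1/2 \<le> L" "0 < a"
  shows "integral {a..b} (piece L m) - integral {a..b} (piece L (Suc m))
    = integral {a - real m..b - real m} (\<lambda>z. gap L z / (real m + z)\<^sup>2)"
proof -
  have "integral {a..b} (piece L m) - integral {a..b} (piece L (Suc m)) = integral {a..b} (\<lambda>x. piece L m x - piece L (Suc m) x)"
    using assms by (intro Henstock_Kurzweil_Integration.integral_diff[symmetric] piece_integrable)
  also have "\<dots> = integral {(a - real m) + real m..(b - real m) + real m} (\<lambda>x. piece L m x - piece L (Suc m) x)"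
    by simp
  also have "\<dots> = integral {a - real m..b - real m} ((\<lambda>x. piece L m x - piece L (Suc m) x) \<circ> (+) (real m))"
    by (rule integral_shift_Icc_real[symmetric])
  also have "(\<lambda>x. piece L m x - piece L (Suc m) x) \<circ> (+) (real m) = (\<lambda>z. gap L z / (real m + z)\<^sup>2)"
    using piece_diff[OF assms(1), of m] by (simp add: o_def add.commute fun_eq_iff)
  finally show ?thesis .
qed

lemma gap_zero: "1/2 \<le> L \<Longrightarrow> L \<le> z \<Longrightarrow> z \<le> 1 \<Longrightarrow> gap L z = 0"
  by (simp add: gap_def bump_right_zero)

lemma deficit_eq_integral:
  assumes "1/2 \<le> L" "L \<le> 1" "1/2 \<le> x" "x \<le> real m + 1"
  shows "deficit L m x = integral {x - real m..L} (\<lambda>z. gap L z / (real m + z)\<^sup>2)"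
proof -
  let ?w = "\<lambda>z. gap L z / (real m + z)\<^sup>2"
  have "deficit L m x = integral {x - real m..1} ?w"
    unfolding deficit_def using assms integral_piece_diff[of L x "real m + 1" m] by (simp add: mass_diff)
  also have "\<dots> = integral {x - real m..L} ?w"
  proof (cases "x - real m \<le> L")
    case True
    have "integral {L..1} ?w = integral {L..1} (\<lambda>_. 0)"
      using assms by (intro integral_cong) (auto simp: gap_zero)
    then show ?thesis
      using Henstock_Kurzweil_Integration.integral_combine[of "x - real m" L 1 ?w] True assms
      by (simp add: integrable_gap_weight)
  next
    case False
    have "integral {x - real m..1} ?w = integral {x - real m..1} (\<lambda>_. 0)"
      using assms False by (intro integral_cong) (auto simp: gap_zero)
    then show ?thesis using False by simp
  qed
  finally show ?thesis .
qed

lemma deficit_eq_sum_levels: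
  assumes "1/2 \<le> L" "L \<le> 1" "1/2 \<le> x" "x \<le> real m + 1" "L - 2 * L * real K \<le> x - real m"
  shows "deficit L m x = (\<Sum>k<K. level L (real m - 2 * L * real k) (clip L (x - real m + 2 * L * real k)))"
proof (cases "x - real m \<le> L")
  case True
  then show ?thesis
    using assms by (simp add: deficit_eq_integral integral_gap_eq_sum_levels)
next
  case False
  then show ?thesis
    using assms sum_levels_beyond[of L "x - real m" "real m" K] by (simp add: deficit_eq_integral)
qed

lemma deficit_zero:
  assumes "1/2 \<le> L" "L \<le> 1" "real m + L \<le> x" "x \<le> real m + 1"
  shows "deficit L m x = 0"
proof -
  have "1/2 \<le> x" using assms by linarith
  then show ?thesis using assms
    by (cases "x - real m = L") (simp_all add: deficit_eq_integral)
qed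

text \<open>
  After a late switch all half-waves on the way come \<open>2 L - 1\<close> later than they could, where the weight is
  smaller.
\<close>
lemma deficit_pos:
  assumes "1/2 < L" "L \<le> 1" "real m + 1 < x"
  shows "0 < deficit L m x"
proof -
  define n where "n = real m + 1"
  define Y where "Y = x - n"
  let ?s = "2 * L - 1"
  have Y: "0 < Y" "1 \<le> n" using assms by (simp_all add: Y_def n_def)
  let ?u = "\<lambda>w. bump L w / (n + w)\<^sup>2" and ?v = "\<lambda>w. bump L w / (n + ?s + w)\<^sup>2"
  have d: "deficit L m x = integral {n..x} (piece L (Suc m)) - integral {n..x} (piece L m)"
    using mass_diff[of n x L m] mass_diff[of n x L "Suc m"] assms by (simp add: deficit_def n_def)
  have u: "integral {n..x} (piece L (Suc m)) = integral {0..Y} ?u"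
    using integral_shift_Icc_real[of 0 Y "piece L (Suc m)" n]
    by (simp add: Y_def o_def piece_def n_def)
  have v: "integral {n..x} (piece L m) = integral {-?s..Y - ?s} ?v"
  proof -
    have "piece L m (n + ?s + w) = ?v w" for w
      using bump_periodic[of L w 1] assms by (simp add: piece_def n_def algebra_simps)
    then show ?thesis
      using integral_shift_Icc_real[of "-?s" "Y - ?s" "piece L m" "n + ?s"]
      by (simp add: Y_def o_def)
  qed
  have "integral {-?s..Y - ?s} ?v \<le> integral {0..Y} ?v"
  proof -
    have "integral {-?s..Y - ?s} ?v \<le> integral {-?s..Y} ?v"
      using assms Y by (intro integral_subset_le integrable_bump_weight) (auto simp: bump_nonneg)
    also have "\<dots> = integral {-?s..0} ?v + integral {0..Y} ?v"
      using assms Y by (intro Henstock_Kurzweil_Integration.integral_combine[symmetric] integrable_bump_weight) auto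
    also have "integral {-?s..0} ?v = integral {-?s..0} (\<lambda>_. 0)"
      using assms by (intro integral_cong) (auto simp: bump_left_zero)
    finally show ?thesis by simp
  qed
  also have "integral {0..Y} ?v < integral {0..Y} ?u"
  proof -
    define y where "y = min Y L"
    have y: "0 < y" "y \<le> Y" "y \<le> L" using Y assms by (auto simp: y_def)
    have strict: "?v w < ?u w" if "0 < w" "w < y" for w
      using that y Y assms by (intro divide_strict_left_mono power_strict_mono bump_pos) auto
    have weak: "?v w \<le> ?u w" if "0 \<le> w" for w
      using that Y assms by (intro divide_left_mono power_mono bump_nonneg) auto
    have cont: "continuous_on {0..y} ?u" "continuous_on {0..y} ?v"
      using Y assms by (intro continuous_intros continuous_on_bump[of _ "\<lambda>x. x"]; force)+
    have "integral {0..y} ?v < integral {0..y} ?u"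
      using integral_less[of 0 y ?v ?u] cont y strict by (auto simp: box_real)
    moreover have "integral {y..Y} ?v \<le> integral {y..Y} ?u"
      using Y y assms weak by (intro integral_le integrable_bump_weight) auto
    moreover have "integral {0..Y} g = integral {0..y} g + integral {y..Y} g" if "g integrable_on {0..Y}" for g :: "real \<Rightarrow> real"
      using y that by (intro Henstock_Kurzweil_Integration.integral_combine[symmetric]) auto
    ultimately show ?thesis
      using Y assms integrable_bump_weight[of n 0 L Y] integrable_bump_weight[of "n + ?s" 0 L Y] by simp
  qed
  finally show ?thesis unfolding d u v by simp
qed

section \<open>Admissible sequences\<close>

text \<open>
  All sequences share the part of the integral over \<open>(0, 1/2)\<close>, which is kept apart.
\<close>
definition cut :: "(nat \<Rightarrow> real) \<Rightarrow> nat \<Rightarrow> real" where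
  "cut \<tau> n = (if n = 0 then 1/2 else \<tau> n)"

definition part :: "real \<Rightarrow> (nat \<Rightarrow> real) \<Rightarrow> nat \<Rightarrow> real" where
  "part L \<tau> n = mass L n (\<tau> (Suc n)) - mass L n (cut \<tau> n)"

text \<open>
  Abel summation: up to a boundary term, the switches contribute independently of each other.
\<close>
lemma part_difference:
  "(\<Sum>n<Suc K. part L real n) - (\<Sum>n<Suc K. part L \<tau> n)
    = (mass L K (real K + 1) - mass L K (\<tau> (Suc K))) + (\<Sum>m<K. deficit L m (\<tau> (Suc m)))"
proof (induction K)
  case 0
  then show ?case by (simp add: part_def cut_def)
next
  case (Suc K)
  then show ?case by (simp add: part_def cut_def deficit_def add_ac)
qed

text \<open>
  The range of \<open>L\<close> corresponds to \<open>2 \<le> p \<le> 4\<close>; the other two conditions are those on \<open>\<tau>\<close> with the least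
  values of \<open>\<delta>\<^sub>1\<close> and \<open>\<delta>\<^sub>2\<close>.
\<close>
locale admissible =
  fixes L :: real and \<tau> :: "nat \<Rightarrow> real"
  assumes L: "1/2 \<le> L" "L \<le> 1"
    and first: "min (2 / pi) L \<le> \<tau> 1"
    and spaced: "\<And>n. 1 \<le> n \<Longrightarrow> \<tau> n + 2/3 \<le> \<tau> (Suc n)"
begin

lemma first_ge: "1/2 \<le> \<tau> 1" "L \<le> 5/9 \<Longrightarrow> L \<le> \<tau> 1" "5/9 \<le> L \<Longrightarrow> 5/9 \<le> \<tau> 1"
proof -
  have "5/9 \<le> 2 / pi" using pi_le by (simp add: field_simps)
  then show "1/2 \<le> \<tau> 1" "L \<le> 5/9 \<Longrightarrow> L \<le> \<tau> 1" "5/9 \<le> L \<Longrightarrow> 5/9 \<le> \<tau> 1"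
    using first L by auto
qed

lemma growth: "3 + 4 * real m \<le> 6 * \<tau> (Suc m)"
proof (induction m)
  case (Suc m)
  then show ?case using spaced[of "Suc m"] by simp
qed (use first_ge in simp)

lemma cut_ge: "1/2 \<le> cut \<tau> n"
  using growth[of "n - 1"] by (cases n) (auto simp: cut_def add_increasing2)

lemma cut_le: "cut \<tau> n \<le> \<tau> (Suc n)"
  using first_ge(1) spaced[of n] by (cases n) (auto simp: cut_def)

text \<open>
  In a period \<open>k \<ge> 1\<close> below the first one, low phases are reached late enough for the offset to be at
  least \<open>2\<close>.  In the first period the offset is the index \<open>m\<close> itself, and \<open>m = 1\<close> is the exceptional case;
  there the bound on \<open>\<tau>\<^sub>1\<close> is used in the form \<open>\<tau>\<^sub>1 \<ge> min (5/9) L\<close>.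
\<close>
lemma chain_level:
  assumes "1/2 < L"
  shows "chain L (- (2 * L * real k)) (\<lambda>m. \<tau> (Suc m) - real m + 2 * L * real k)"
proof
  show "1/2 < L" "L \<le> 1" using assms L by auto
  have k: "0 \<le> L * real k" using L by simp
  show "1 - L \<le> 2 * (\<tau> (Suc 0) - real 0 + 2 * L * real k)"
  proof -
    have "\<tau> (Suc 0) \<le> \<tau> (Suc 0) - real 0 + 2 * L * real k" using k by simp
    moreover have "1 - L \<le> 2 * Y" if "\<tau> (Suc 0) \<le> Y" for Y
      using that first_ge(1) L unfolding One_nat_def by linarith
    ultimately show ?thesis by blast
  qed
  fix m
  show "\<tau> (Suc m) - real m + 2 * L * real k - 1/3 \<le> \<tau> (Suc (Suc m)) - real (Suc m) + 2 * L * real k"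
    using spaced[of "Suc m"] by simp
  show "0 < - (2 * L * real k) + real m + (\<tau> (Suc m) - real m + 2 * L * real k)"
    using growth[of m] by simp
  assume low: "2 * (\<tau> (Suc m) - real m + 2 * L * real k) < 1 - L"
  have m: "6 * (L * real k) + 3/2 * L < real m" using growth[of m] low by simp
  show "2 \<le> - (2 * L * real k) + real m \<or> - (2 * L * real k) + real m = 1 \<and> L \<le> 5/9
      \<and> 5/12 - L/2 \<le> \<tau> (Suc m) - real m + 2 * L * real k"
  proof (cases "k = 0")
    case True
    show ?thesis
    proof (cases "m = 1")
      case m1: True
      have "\<tau> 1 + 2/3 \<le> \<tau> 2" using spaced[of 1] by (simp add: numeral_2_eq_2)
      then show ?thesis using True m1 low first_ge L
        by (cases "L \<le> 5/9") (auto simp: numeral_2_eq_2)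
    next
      case False
      have "0 < real m" using m L True by simp
      then show ?thesis using False True by simp
    qed
  next
    case False
    then have "1 \<le> real k" by simp
    then have "1/2 * 1 \<le> L * real k" using L by (intro mult_mono) auto
    then show ?thesis using m L by simp
  qed
qed

lemma deficit_ge_sum_levels:
  assumes "1/2 < L" "m < N"
  shows "(\<Sum>k<Suc N. level L (- (2 * L * real k) + real m) (clip L (\<tau> (Suc m) - real m + 2 * L * real k))) \<le> deficit L m (\<tau> (Suc m))"
proof (cases "\<tau> (Suc m) \<le> real m + 1")
  case True
  define X where "X = L * real N"
  have "1/2 * real N \<le> X" unfolding X_def using L by (intro mult_right_mono) auto
  moreover have "L - 2 * L * real (Suc N) = - L - 2 * X" by (simp add: X_def algebra_simps)
  moreover have "real m \<le> real N" using assms(2) by simp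
  ultimately have "L - 2 * L * real (Suc N) \<le> \<tau> (Suc m) - real m"
    using growth[of m] L by linarith
  then show ?thesis
    using deficit_eq_sum_levels[OF L _ True, of "Suc N"] growth[of m] by (simp add: algebra_simps)
next
  case False
  then show ?thesis
    using sum_levels_beyond[of L "\<tau> (Suc m) - real m" "real m" "Suc N"] deficit_pos[of L m "\<tau> (Suc m)"] assms L
    by (simp add: algebra_simps)
qed

text \<open>
  All periods together cost at least as much as the first one, because each of them costs at least zero.
\<close>
lemma sum_level_le_sum_deficit:
  assumes "1/2 < L"
  shows "(\<Sum>m<N. level L (real m) (clip L (\<tau> (Suc m) - real m))) \<le> (\<Sum>m<N. deficit L m (\<tau> (Suc m)))"
proof -
  let ?l = "\<lambda>k m. level L (- (2 * L * real k) + real m) (clip L (\<tau> (Suc m) - real m + 2 * L * real k))"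
  have nonneg: "0 \<le> (\<Sum>m<N. ?l k m)" for k
    using chain.sum_nonneg[OF chain_level[OF assms, of k], of N]
    unfolding chain.cost_def[OF chain_level[OF assms, of k]] .
  have "(\<Sum>m<N. ?l 0 m) \<le> (\<Sum>k<Suc N. \<Sum>m<N. ?l k m)"
    using nonneg by (intro member_le_sum) auto
  also have "\<dots> = (\<Sum>m<N. \<Sum>k<Suc N. ?l k m)" by (rule sum.swap)
  also have "\<dots> \<le> (\<Sum>m<N. deficit L m (\<tau> (Suc m)))"
    using assms by (intro sum_mono deficit_ge_sum_levels) auto
  finally show ?thesis by simp
qed

lemma sum_deficit_nonneg:
  assumes "1/2 < L" shows "0 \<le> (\<Sum>m<N. deficit L m (\<tau> (Suc m)))"
proof -
  have "0 \<le> (\<Sum>m<N. level L (real m) (clip L (\<tau> (Suc m) - real m)))"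
    using chain.sum_nonneg[OF chain_level[OF assms, of 0], of N]
    unfolding chain.cost_def[OF chain_level[OF assms, of 0]] by simp
  then show ?thesis using sum_level_le_sum_deficit[OF assms, of N] by simp
qed

text \<open>
  The bound by a fixed \<open>\<delta>\<close> is what makes strictness survive the passage to the limit.
\<close>
lemma sum_deficit_pos:
  assumes "1/2 < L" and m0: "\<tau> (Suc m0) \<notin> {real m0 + L..real m0 + 1}"
  shows "\<exists>\<delta>>0. \<exists>N0. \<forall>N\<ge>N0. \<delta> \<le> (\<Sum>m<N. deficit L m (\<tau> (Suc m)))"
proof (cases "\<exists>m. \<tau> (Suc m) - real m < L")
  case True
  then obtain m where "\<tau> (Suc m) - real m < L" by blast
  then have "\<exists>\<delta>>0. \<exists>N0. \<forall>N\<ge>N0. \<delta> \<le> (\<Sum>m<N. level L (real m) (clip L (\<tau> (Suc m) - real m)))"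
    using chain.sum_pos[OF chain_level[OF assms(1), of 0], of m]
    unfolding chain.cost_def[OF chain_level[OF assms(1), of 0]] by simp
  then show ?thesis using sum_level_le_sum_deficit[OF assms(1)] by (meson order_trans)
next
  case False
  have nonneg: "0 \<le> deficit L m (\<tau> (Suc m))" for m
    using deficit_zero[OF L, of m "\<tau> (Suc m)"] deficit_pos[OF assms(1) L(2), of m "\<tau> (Suc m)"] False
    by (cases "\<tau> (Suc m) \<le> real m + 1") (force simp: not_less le_diff_eq add.commute)+
  have "\<not> \<tau> (Suc m0) - real m0 < L" using False by blast
  then have "0 < deficit L m0 (\<tau> (Suc m0))"
    using m0 by (intro deficit_pos assms L) auto
  moreover have "deficit L m0 (\<tau> (Suc m0)) \<le> (\<Sum>m<N. deficit L m (\<tau> (Suc m)))" if "Suc m0 \<le> N" for N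
    using that nonneg by (intro member_le_sum) auto
  ultimately show ?thesis by blast
qed

end

lemma integral_piece_bounds:
  assumes "0 < a" "a \<le> b"
  shows "0 \<le> integral {a..b} (piece L n)" "integral {a..b} (piece L n) \<le> 1 / a - 1 / b"
proof -
  show "0 \<le> integral {a..b} (piece L n)"
    using assms by (intro integral_nonneg piece_integrable) (auto simp: piece_def bump_nonneg)
  have "((\<lambda>x. 1 / x\<^sup>2) has_integral (- 1 / b) - (- 1 / a)) {a..b}"
  proof (rule fundamental_theorem_of_calculus[OF assms(2)])
    fix x assume "x \<in> {a..b}"
    then have "((\<lambda>x. - 1 / x) has_real_derivative 1 / x\<^sup>2) (at x)"
      using assms by (auto intro!: derivative_eq_intros simp: power2_eq_square)
    then show "((\<lambda>x. - 1 / x) has_vector_derivative 1 / x\<^sup>2) (at x within {a..b})"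
      by (simp add: has_real_derivative_iff_has_vector_derivative has_vector_derivative_at_within)
  qed
  then have i: "((\<lambda>x. 1 / x\<^sup>2) has_integral 1 / a - 1 / b) {a..b}" by simp
  have "integral {a..b} (piece L n) \<le> integral {a..b} (\<lambda>x. 1 / x\<^sup>2)"
    using assms i by (intro integral_le piece_integrable) (auto simp: piece_def bump_le_1 divide_right_mono)
  then show "integral {a..b} (piece L n) \<le> 1 / a - 1 / b" using i by (simp add: integral_unique)
qed

context admissible
begin

lemma part_eq: "part L \<tau> n = integral {cut \<tau> n..\<tau> (Suc n)} (piece L n)"
  unfolding part_def by (rule mass_diff[OF cut_ge cut_le])

lemma part_nonneg: "0 \<le> part L \<tau> n"
  unfolding part_eq using cut_ge[of n] cut_le[of n] by (intro integral_piece_bounds) auto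

lemma part_summable: "summable (part L \<tau>)"
proof (rule summableI_nonneg_bounded[OF part_nonneg])
  fix N
  have "(\<Sum>n<N. part L \<tau> n) \<le> 2 - 1 / cut \<tau> N"
  proof (induction N)
    case (Suc N)
    have "part L \<tau> N \<le> 1 / cut \<tau> N - 1 / \<tau> (Suc N)"
      unfolding part_eq using cut_ge[of N] cut_le[of N] by (intro integral_piece_bounds) auto
    then show ?case using Suc by (simp add: cut_def)
  qed (simp add: cut_def)
  also have "\<dots> \<le> 2" using cut_ge[of N] by simp
  finally show "(\<Sum>n<N. part L \<tau> n) \<le> 2" .
qed

lemma boundary_tendsto_0: "(\<lambda>K. mass L K (real K + 1) - mass L K (\<tau> (Suc K))) \<longlonglongrightarrow> 0"
proof (rule Lim_null_comparison)
  have "\<bar>mass L K (real K + 1) - mass L K (\<tau> (Suc K))\<bar> \<le> 1 / (1/2 + 2/3 * real K)" for K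
  proof -
    let ?b = "1/2 + 2/3 * real K"
    have *: "\<bar>mass L K b - mass L K a\<bar> \<le> 1 / ?b" if "?b \<le> a" "a \<le> b" for a b
    proof -
      have a: "1/2 \<le> a" by (rule order_trans[OF _ that(1)]) simp
      have "0 \<le> mass L K b - mass L K a" "mass L K b - mass L K a \<le> 1 / a - 1 / b"
        unfolding mass_diff[OF a that(2)] using a that by (intro integral_piece_bounds; simp)+
      moreover have "1 / a \<le> 1 / ?b" "0 \<le> 1 / b"
        using a that by (auto intro!: divide_left_mono add_pos_nonneg mult_pos_pos)
      ultimately show ?thesis unfolding abs_le_iff by linarith
    qed
    show ?thesis
      using *[of "\<tau> (Suc K)" "real K + 1"] *[of "real K + 1" "\<tau> (Suc K)"] growth[of K]
      by (cases "\<tau> (Suc K) \<le> real K + 1") (auto simp: abs_minus_commute)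
  qed
  then show "\<forall>\<^sub>F K in sequentially. norm (mass L K (real K + 1) - mass L K (\<tau> (Suc K))) \<le> 1 / (1/2 + 2/3 * real K)"
    by simp
  show "(\<lambda>K. 1 / (1/2 + 2/3 * real K)) \<longlonglongrightarrow> 0"
    by real_asymp
qed

end

lemma admissible_real: "1/2 \<le> L \<Longrightarrow> L \<le> 1 \<Longrightarrow> admissible L real"
  by unfold_locales auto

context admissible
begin

lemma sum_deficit_tendsto:
  "(\<lambda>K. \<Sum>m<K. deficit L m (\<tau> (Suc m))) \<longlonglongrightarrow> (\<Sum>n. part L real n) - (\<Sum>n. part L \<tau> n)"
proof -
  have "(\<lambda>K. (\<Sum>n<Suc K. part L real n) - (\<Sum>n<Suc K. part L \<tau> n)) \<longlonglongrightarrow> (\<Sum>n. part L real n) - (\<Sum>n. part L \<tau> n)"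
    using admissible.part_summable[OF admissible_real[OF L]] part_summable
    by (intro tendsto_diff LIMSEQ_Suc summable_LIMSEQ)
  from tendsto_diff[OF this[unfolded part_difference] boundary_tendsto_0] show ?thesis by simp
qed

lemma total_le: "(\<Sum>n. part L \<tau> n) \<le> (\<Sum>n. part L real n)"
  and total_eq_iff: "1/2 < L \<Longrightarrow> (\<Sum>n. part L \<tau> n) = (\<Sum>n. part L real n) \<longleftrightarrow> (\<forall>m. \<tau> (Suc m) \<in> {real m + L..real m + 1})"
  and total_eq_half: "L = 1/2 \<Longrightarrow> (\<Sum>n. part L \<tau> n) = (\<Sum>n. part L real n)"
proof -
  show half: "(\<Sum>n. part L \<tau> n) = (\<Sum>n. part L real n)" if "L = 1/2"
  proof -
    have "mass L m = mass L (Suc m)" for m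
    proof -
      have "piece L m x = piece L (Suc m) x" for x
      proof -
        have "bump L (x - real (Suc m) + 2 * L * of_int 1) = bump L (x - real (Suc m))"
          using that by (intro bump_periodic) simp
        moreover have "x - real (Suc m) + 2 * L * of_int 1 = x - real m" using that by simp
        ultimately show ?thesis by (simp only: piece_def)
      qed
      then show ?thesis by (simp add: mass_def fun_eq_iff cong: integral_cong)
    qed
    then have "deficit L m x = 0" for m x by (simp add: deficit_def)
    then show ?thesis using sum_deficit_tendsto by (simp add: LIMSEQ_const_iff)
  qed
  show "(\<Sum>n. part L \<tau> n) \<le> (\<Sum>n. part L real n)"
  proof (cases "L = 1/2")
    case False
    then have "0 \<le> (\<Sum>n. part L real n) - (\<Sum>n. part L \<tau> n)"
      using sum_deficit_nonneg L by (intro LIMSEQ_le_const[OF sum_deficit_tendsto]) auto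
    then show ?thesis by simp
  qed (use half in simp)
  show "(\<Sum>n. part L \<tau> n) = (\<Sum>n. part L real n) \<longleftrightarrow> (\<forall>m. \<tau> (Suc m) \<in> {real m + L..real m + 1})" if L': "1/2 < L"
  proof
    assume eq: "(\<Sum>n. part L \<tau> n) = (\<Sum>n. part L real n)"
    show "\<forall>m. \<tau> (Suc m) \<in> {real m + L..real m + 1}"
    proof (rule ccontr)
      assume "\<not> ?thesis"
      then obtain \<delta> N0 where "0 < \<delta>" "\<forall>N\<ge>N0. \<delta> \<le> (\<Sum>m<N. deficit L m (\<tau> (Suc m)))"
        using sum_deficit_pos[OF L'] by blast
      then have "\<delta> \<le> (\<Sum>n. part L real n) - (\<Sum>n. part L \<tau> n)"
        by (intro LIMSEQ_le_const[OF sum_deficit_tendsto]) blast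
      then show False using eq \<open>0 < \<delta>\<close> by simp
    qed
  next
    assume "\<forall>m. \<tau> (Suc m) \<in> {real m + L..real m + 1}"
    then have "deficit L m (\<tau> (Suc m)) = 0" for m
      using deficit_zero[OF L, of m "\<tau> (Suc m)"] by simp
    then show "(\<Sum>n. part L \<tau> n) = (\<Sum>n. part L real n)"
      using sum_deficit_tendsto by (simp add: LIMSEQ_const_iff)
  qed
qed

end

section \<open>The extremal problem\<close>

definition slice :: "real \<Rightarrow> (nat \<Rightarrow> real) \<Rightarrow> nat \<Rightarrow> ennreal" where
  "slice L \<tau> n = (\<integral>\<^sup>+x\<in>{\<tau> n<..<\<tau> (Suc n)}. ennreal (piece L n x / pi\<^sup>2) \<partial>lborel)"

lemma piece_nonneg: "0 \<le> piece L n x"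
  by (simp add: piece_def bump_nonneg)

lemma piece_measurable [measurable]: "piece L n \<in> borel_measurable borel"
  unfolding piece_def bump_def by measurable

text \<open>
  On the slice only the term \<open>n\<close> of the defining series is nonzero.
\<close>
lemma Kp_on_slice:
  assumes \<tau>: "strict_mono \<tau>" "0 \<le> \<tau> n" and x: "\<tau> n < x" "x < \<tau> (Suc n)" and p: "0 < p"
  shows "(max 0 (Kp p \<tau> x))\<^sup>2 = piece (2 / p) n x / pi\<^sup>2"
proof -
  have "x \<notin> {\<tau> m<..<\<tau> (Suc m)}" if "m \<noteq> n" for m
  proof (cases "m < n")
    case True
    then have "\<tau> (Suc m) \<le> \<tau> n" using \<tau>(1) by (simp add: strict_mono_less_eq)
    then show ?thesis using x by auto
  next
    case False
    then have "\<tau> (Suc n) \<le> \<tau> m" using \<tau>(1) that by (simp add: strict_mono_less_eq)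
    then show ?thesis using x by auto
  qed
  then have "Kp p \<tau> x = (\<Sum>m\<in>{n}. indicator {\<tau> m<..<\<tau> (Suc m)} x * (sin (p / 2 * pi * (x - real m)) / (pi * x)))"
    unfolding Kp_def by (intro suminf_finite) auto
  also have "\<dots> = sin (pi * (x - real n) / (2 / p)) / (pi * x)"
    using x by (simp add: ac_simps)
  finally have "Kp p \<tau> x = sin (pi * (x - real n) / (2 / p)) / (pi * x)" .
  moreover have "max 0 (a / c) = max 0 a / c" if "0 < c" for a c :: real
    using that by (simp add: max_def zero_le_divide_iff)
  then have "max 0 (a / (pi * x)) = max 0 a / (pi * x)" for a
    using x \<tau>(2) by simp
  ultimately show ?thesis
    by (simp add: piece_def bump_def power_divide power_mult_distrib ac_simps)
qed

lemma Ep_eq_suminf_slice: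
  assumes \<tau>: "strict_mono \<tau>" "\<tau> 0 = 0" "filterlim \<tau> at_top sequentially" and p: "0 < p"
  shows "Ep p \<tau> = (\<Sum>n. slice (2 / p) \<tau> n)"
proof -
  let ?g = "\<lambda>n x. ennreal (piece (2 / p) n x / pi\<^sup>2) * indicator {\<tau> n<..<\<tau> (Suc n)} x"
  have nonneg: "0 \<le> \<tau> n" for n using \<tau>(1,2) strict_mono_less_eq[of \<tau> 0 n] by simp
  have "AE x in lborel. x \<notin> range \<tau>"
    by (intro AE_not_in countable_imp_null_set_lborel) auto
  then have "Ep p \<tau> = (\<integral>\<^sup>+x. (\<Sum>n. ?g n x) \<partial>lborel)"
    unfolding Ep_def
  proof (intro nn_integral_cong_AE, eventually_elim)
    fix x assume x: "x \<notin> range \<tau>"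
    show "ennreal ((max 0 (Kp p \<tau> x))\<^sup>2) * indicator {0<..} x = (\<Sum>n. ?g n x)"
    proof (cases "0 < x")
      case True
      have "\<exists>n. x < \<tau> n"
        using \<tau>(3) by (auto simp: filterlim_at_top_dense eventually_sequentially)
      then obtain N where N: "x < \<tau> N" "\<And>n. n < N \<Longrightarrow> \<not> x < \<tau> n"
        using exists_least_iff[of "\<lambda>n. x < \<tau> n"] by auto
      have "N \<noteq> 0" using N(1) True \<tau>(2) by (cases "N = 0") auto
      then obtain n where n: "N = Suc n" by (cases N) auto
      have "\<tau> n < x" using N(2)[of n] x by (auto simp: n not_less order_le_less)
      then have xn: "\<tau> n < x" "x < \<tau> (Suc n)" using N n by auto
      have "?g m x = 0" if "m \<noteq> n" for m
      proof (cases "m < n")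
        case True
        then have "\<tau> (Suc m) \<le> \<tau> n" using \<tau>(1) by (simp add: strict_mono_less_eq)
        then show ?thesis using xn by auto
      next
        case False
        then have "\<tau> (Suc n) \<le> \<tau> m" using \<tau>(1) that by (simp add: strict_mono_less_eq)
        then show ?thesis using xn by auto
      qed
      then have "(\<Sum>m. ?g m x) = (\<Sum>m\<in>{n}. ?g m x)" by (intro suminf_finite) auto
      also have "\<dots> = ennreal ((max 0 (Kp p \<tau> x))\<^sup>2) * indicator {0<..} x"
        using Kp_on_slice[OF \<tau>(1) nonneg xn p] xn True by simp
      finally show ?thesis ..
    next
      case False
      have "?g n x = 0" for n using False nonneg[of n] by auto
      then have "(\<Sum>n. ?g n x) = (\<Sum>n. 0)" by (intro suminf_cong)
      then show ?thesis using False by simp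
    qed
  qed
  also have "\<dots> = (\<Sum>n. \<integral>\<^sup>+x. ?g n x \<partial>lborel)"
    by (intro nn_integral_suminf) measurable
  finally show ?thesis by (simp add: slice_def)
qed

lemma nn_integral_piece:
  assumes "0 < a" "a \<le> b"
  shows "(\<integral>\<^sup>+x\<in>{a<..<b}. ennreal (piece L n x / pi\<^sup>2) \<partial>lborel) = ennreal (integral {a..b} (piece L n) / pi\<^sup>2)"
proof -
  have "((\<lambda>x. piece L n x / pi\<^sup>2) has_integral integral {a..b} (piece L n) / pi\<^sup>2) {a..b}"
    using assms by (intro has_integral_divide integrable_integral piece_integrable)
  then have "(\<integral>\<^sup>+x\<in>{a..b}. ennreal (piece L n x / pi\<^sup>2) \<partial>lborel) = ennreal (integral {a..b} (piece L n) / pi\<^sup>2)"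
    by (intro nn_integral_has_integral_lebesgue') (auto simp: piece_nonneg)
  moreover have "AE x in lborel. x \<noteq> a" "AE x in lborel. x \<noteq> b" by (auto intro: AE_lborel_singleton)
  then have "(\<integral>\<^sup>+x\<in>{a<..<b}. ennreal (piece L n x / pi\<^sup>2) \<partial>lborel) = (\<integral>\<^sup>+x\<in>{a..b}. ennreal (piece L n x / pi\<^sup>2) \<partial>lborel)"
    by (intro nn_integral_cong_AE, eventually_elim) (auto simp: indicator_def)
  ultimately show ?thesis by simp
qed

definition initial :: "real \<Rightarrow> ennreal" where
  "initial L = (\<integral>\<^sup>+x\<in>{0<..<1/2}. ennreal (piece L 0 x / pi\<^sup>2) \<partial>lborel)"

text \<open>
  By \<open>\<bar>sin y\<bar> \<le> \<bar>y\<bar>\<close> the integrand is bounded near zero.  Finiteness is needed to cancel this common part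
  when two values of \<open>E\<^sub>p\<close> are compared.
\<close>
lemma initial_finite:
  assumes "0 < L" shows "initial L < \<infinity>"
proof -
  have "piece L 0 x / pi\<^sup>2 \<le> 1 / L\<^sup>2" for x
  proof (cases "x = 0")
    case False
    have "\<bar>max 0 (sin (pi * x / L))\<bar> \<le> \<bar>pi * x / L\<bar>"
      using abs_sin_x_le_abs_x[of "pi * x / L"] by (auto simp: max_def)
    then have "bump L x \<le> (pi * x / L)\<^sup>2" unfolding bump_def by (rule abs_le_square_iff[THEN iffD1])
    then show ?thesis using False assms
      by (simp add: piece_def divide_simps power_mult_distrib power_divide mult.commute)
  qed (simp add: piece_def)
  then have "initial L \<le> (\<integral>\<^sup>+x\<in>{0<..<1/2::real}. ennreal (1 / L\<^sup>2) \<partial>lborel)"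
    unfolding initial_def by (intro nn_integral_mono) (auto simp: indicator_def intro!: ennreal_leI)
  also have "\<dots> = ennreal (1 / L\<^sup>2) * emeasure lborel {0<..<1/2::real}"
    by (rule nn_integral_cmult_indicator) simp
  also have "emeasure lborel {0<..<1/2::real} = ennreal (1/2)" by simp
  also have "ennreal (1 / L\<^sup>2) * ennreal (1/2) = ennreal (1 / L\<^sup>2 * (1/2))" by (rule ennreal_mult[symmetric]) auto
  also have "\<dots> < \<infinity>" by (simp only: infinity_ennreal_def ennreal_less_top)
  finally show ?thesis .
qed

context admissible
begin

lemma slice_eq:
  assumes "\<tau> 0 = 0"
  shows "slice L \<tau> n = (if n = 0 then initial L else 0) + ennreal (part L \<tau> n / pi\<^sup>2)"
proof (cases "n = 0")
  case False
  then have "cut \<tau> n = \<tau> n" by (simp add: cut_def)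
  then show ?thesis
    using cut_ge[of n] cut_le[of n] False by (simp add: slice_def nn_integral_piece part_eq)
next
  case True
  let ?h = "\<lambda>x. ennreal (piece L 0 x / pi\<^sup>2)"
  have \<tau>1: "1/2 \<le> \<tau> (Suc 0)" using first_ge(1) by simp
  have "slice L \<tau> 0 = (\<integral>\<^sup>+x. ?h x * indicator {0<..<1/2} x + ?h x * indicator {1/2<..<\<tau> (Suc 0)} x \<partial>lborel)"
    unfolding slice_def
  proof (intro nn_integral_cong_AE)
    have "AE x in lborel. x \<noteq> (1/2::real)" by (rule AE_lborel_singleton)
    then show "AE x in lborel. ?h x * indicator {\<tau> 0<..<\<tau> (Suc 0)} x
        = ?h x * indicator {0<..<1/2} x + ?h x * indicator {1/2<..<\<tau> (Suc 0)} x"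
      by eventually_elim (use \<tau>1 assms in \<open>auto simp: indicator_def\<close>)
  qed
  also have "\<dots> = initial L + (\<integral>\<^sup>+x\<in>{1/2<..<\<tau> (Suc 0)}. ?h x \<partial>lborel)"
    unfolding initial_def by (intro nn_integral_add) measurable
  also have "(\<integral>\<^sup>+x\<in>{1/2<..<\<tau> (Suc 0)}. ?h x \<partial>lborel) = ennreal (part L \<tau> 0 / pi\<^sup>2)"
    using \<tau>1 by (simp add: nn_integral_piece part_eq cut_def)
  finally show ?thesis using True by simp
qed

lemma suminf_slice:
  assumes "\<tau> 0 = 0"
  shows "(\<Sum>n. slice L \<tau> n) = initial L + ennreal ((\<Sum>n. part L \<tau> n) / pi\<^sup>2)"
proof -
  have "(\<Sum>n. slice L \<tau> n) = (\<Sum>n. if n = 0 then initial L else 0) + (\<Sum>n. ennreal (part L \<tau> n / pi\<^sup>2))"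
    unfolding slice_eq[OF assms] by (intro suminf_add[symmetric]) auto
  also have "(\<Sum>n. if n = 0 then initial L else 0) = (\<Sum>n\<in>{0::nat}. if n = 0 then initial L else 0)"
    by (intro suminf_finite) auto
  also have "(\<Sum>n. ennreal (part L \<tau> n / pi\<^sup>2)) = ennreal (\<Sum>n. part L \<tau> n / pi\<^sup>2)"
    by (intro suminf_ennreal2 summable_divide part_summable) (simp add: part_nonneg)
  also have "(\<Sum>n. part L \<tau> n / pi\<^sup>2) = (\<Sum>n. part L \<tau> n) / pi\<^sup>2"
    by (rule suminf_divide[OF part_summable])
  finally show ?thesis by simp
qed

lemma filterlim_at_top: "filterlim \<tau> at_top sequentially"
proof -
  have "filterlim (\<lambda>m. \<tau> (Suc m)) at_top sequentially"
  proof (rule filterlim_at_top_mono)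
    show "filterlim (\<lambda>m. 1/2 + 2/3 * real m) at_top sequentially" by real_asymp
    show "\<forall>\<^sub>F m in sequentially. 1/2 + 2/3 * real m \<le> \<tau> (Suc m)"
      using growth by (intro always_eventually) (simp add: field_simps)
  qed
  then show ?thesis by (simp add: filterlim_sequentially_Suc)
qed

end

lemma slice_real:
  assumes "1/2 \<le> L" "L \<le> 1"
  shows "slice L real n = (\<integral>\<^sup>+x\<in>{real n..real n + L}. ennreal ((sin (pi * (x - real n) / L))\<^sup>2 / (pi\<^sup>2 * x\<^sup>2)) \<partial>lborel)"
  unfolding slice_def
proof (intro nn_integral_cong_AE)
  have "AE x in lborel. x \<noteq> real n" "AE x in lborel. x \<noteq> real n + L" "AE x in lborel. x \<noteq> real n + 1"
    by (rule AE_lborel_singleton)+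
  then show "AE x in lborel. ennreal (piece L n x / pi\<^sup>2) * indicator {real n<..<real (Suc n)} x
      = ennreal ((sin (pi * (x - real n) / L))\<^sup>2 / (pi\<^sup>2 * x\<^sup>2)) * indicator {real n..real n + L} x"
  proof eventually_elim
    fix x assume x: "x \<noteq> real n" "x \<noteq> real n + L" "x \<noteq> real n + 1"
    consider "x < real n \<or> real n + 1 < x" | "real n < x" "x < real n + L" | "real n + L < x" "x < real n + 1"
      using x assms by linarith
    then show "ennreal (piece L n x / pi\<^sup>2) * indicator {real n<..<real (Suc n)} x
      = ennreal ((sin (pi * (x - real n) / L))\<^sup>2 / (pi\<^sup>2 * x\<^sup>2)) * indicator {real n..real n + L} x"
    proof cases
      case 1
      then show ?thesis using assms by (auto simp: indicator_def)
    next
      case 2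
      then have "bump L (x - real n) = (sin (pi * (x - real n) / L))\<^sup>2"
        using assms by (intro bump_eq_sin) auto
      then show ?thesis using 2 assms by (simp add: piece_def indicator_def ac_simps)
    next
      case 3
      then have "bump L (x - real n) = 0" using assms by (intro bump_right_zero) auto
      then show ?thesis using 3 by (simp add: piece_def indicator_def)
    qed
  qed
qed

theorem theorem1p2:
  fixes p \<delta>1 \<delta>2 :: real
  assumes "2 \<le> p" "p \<le> 4"
    and "min (2 / pi) (2 / p) \<le> \<delta>1" "\<delta>1 \<le> 1"
    and "2 / 3 \<le> \<delta>2" "\<delta>2 \<le> 1"
  shows "Esup p \<delta>1 \<delta>2 =
           (\<Sum>n. \<integral>\<^sup>+x\<in>{real n..real n + 2 / p}.
              ennreal ((sin (p / 2 * pi * (x - real n)))\<^sup>2 / (pi\<^sup>2 * x\<^sup>2)) \<partial>lborel)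
       \<and> (p < 4 \<longrightarrow>
            (\<forall>\<tau>\<in>Tseq \<delta>1 \<delta>2.
               Ep p \<tau> = Esup p \<delta>1 \<delta>2 \<longleftrightarrow> (\<forall>n\<ge>1. \<tau> n \<in> {real n - 1 + 2 / p..real n})))
       \<and> (p = 4 \<longrightarrow> (\<forall>\<tau>\<in>Tseq \<delta>1 \<delta>2. Ep p \<tau> = Esup p \<delta>1 \<delta>2))"
proof -
  define L where "L = 2 / p"
  have p: "0 < p" and L: "1/2 \<le> L" "L \<le> 1" using assms by (auto simp: L_def field_simps)
  have adm: "admissible L \<tau>" if "\<tau> \<in> Tseq \<delta>1 \<delta>2" for \<tau>
    using that assms L by unfold_locales (force simp: Tseq_def L_def)+
  have Ep: "Ep p \<tau> = initial L + ennreal ((\<Sum>n. part L \<tau> n) / pi\<^sup>2)" if "\<tau> \<in> Tseq \<delta>1 \<delta>2" for \<tau>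
  proof -
    have "strict_mono \<tau>" "\<tau> 0 = 0" using that by (auto simp: Tseq_def)
    then show ?thesis
      using Ep_eq_suminf_slice[of \<tau> p] admissible.filterlim_at_top[OF adm[OF that]] p
        admissible.suminf_slice[OF adm[OF that]] by (simp add: L_def)
  qed
  have real_T: "real \<in> Tseq \<delta>1 \<delta>2" using assms by (auto simp: Tseq_def strict_mono_def)
  have sup: "Esup p \<delta>1 \<delta>2 = Ep p real"
    unfolding Esup_def
  proof (rule antisym)
    show "(SUP \<tau>\<in>Tseq \<delta>1 \<delta>2. Ep p \<tau>) \<le> Ep p real"
      using admissible.total_le[OF adm] real_T
      by (intro SUP_least) (auto simp: Ep intro!: add_left_mono ennreal_leI divide_right_mono)
  qed (use real_T in \<open>auto intro: SUP_upper\<close>)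
  have "Ep p real = (\<Sum>n. slice L real n)"
    using Ep_eq_suminf_slice[of real p] p by (simp add: L_def strict_mono_def filterlim_real_sequentially)
  also have "\<dots> = (\<Sum>n. \<integral>\<^sup>+x\<in>{real n..real n + 2 / p}.
      ennreal ((sin (p / 2 * pi * (x - real n)))\<^sup>2 / (pi\<^sup>2 * x\<^sup>2)) \<partial>lborel)"
    unfolding slice_real[OF L] by (simp add: L_def ac_simps)
  finally have ref: "Ep p real = \<dots>" .
  have eq_iff: "Ep p \<tau> = Esup p \<delta>1 \<delta>2 \<longleftrightarrow> (\<Sum>n. part L \<tau> n) = (\<Sum>n. part L real n)"
    if "\<tau> \<in> Tseq \<delta>1 \<delta>2" for \<tau>
  proof -
    have "0 \<le> (\<Sum>n. part L \<sigma> n)" if "\<sigma> \<in> Tseq \<delta>1 \<delta>2" for \<sigma>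
      using admissible.part_nonneg[OF adm[OF that]] admissible.part_summable[OF adm[OF that]] by (simp add: suminf_nonneg)
    then show ?thesis
      unfolding sup Ep[OF that] Ep[OF real_T] using less_imp_neq[OF initial_finite[of L]] L that real_T
      by (simp add: ennreal_add_left_cancel)
  qed
  have shift: "(\<forall>m. \<tau> (Suc m) \<in> {real m + L..real m + 1}) \<longleftrightarrow> (\<forall>n\<ge>1. \<tau> n \<in> {real n - 1 + 2 / p..real n})" for \<tau>
  proof
    assume *: "\<forall>m. \<tau> (Suc m) \<in> {real m + L..real m + 1}"
    show "\<forall>n\<ge>1. \<tau> n \<in> {real n - 1 + 2 / p..real n}"
    proof (intro allI impI)
      fix n :: nat assume "1 \<le> n"
      then obtain m where "n = Suc m" by (cases n) auto
      then show "\<tau> n \<in> {real n - 1 + 2 / p..real n}" using *[rule_format, of m] by (simp add: L_def add.commute)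
    qed
  next
    assume *: "\<forall>n\<ge>1. \<tau> n \<in> {real n - 1 + 2 / p..real n}"
    show "\<forall>m. \<tau> (Suc m) \<in> {real m + L..real m + 1}"
      using *[rule_format, of "Suc _"] by (simp add: L_def add.commute)
  qed
  have lt: "Ep p \<tau> = Esup p \<delta>1 \<delta>2 \<longleftrightarrow> (\<forall>n\<ge>1. \<tau> n \<in> {real n - 1 + 2 / p..real n})"
    if "p < 4" "\<tau> \<in> Tseq \<delta>1 \<delta>2" for \<tau>
  proof -
    have "1/2 < L" using that p by (simp add: L_def field_simps)
    then show ?thesis
      using eq_iff[OF that(2)] shift[of \<tau>] admissible.total_eq_iff[OF adm[OF that(2)]] by blast
  qed
  have four: "Ep p \<tau> = Esup p \<delta>1 \<delta>2" if "p = 4" "\<tau> \<in> Tseq \<delta>1 \<delta>2" for \<tau>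
  proof -
    have "L = 1/2" using that by (simp add: L_def)
    then show ?thesis using eq_iff[OF that(2)] admissible.total_eq_half[OF adm[OF that(2)]] by blast
  qed
  show ?thesis using sup[unfolded ref] lt four by blast
qed

end
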